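(* Let $K\ge1$ be an integer, $Q>0$, and let $T>0$ be the total storage budget, with $K\ge\lceil T\rceil$. In the wireless cloud storage model described in the context, the optimal storage allocation in the low SNR regime consists of $\lfloor T\rfloor$ nodes with storage size $1$ and one incomplete storage node of storage size $T-\lfloor T\rfloor$. That is, let $\mathbf{a}_{\min}$ be the allocation in which $\lfloor T\rfloor$ nodes have $a_i=1$, one further node has $a_i=T-\lfloor T\rfloor$ (this further node being absent when $T$ is an integer), and all other nodes have $a_i=0$. Then for every allocation $\mathbf{a}=(a_1,\ldots,a_K)$ with $a_i\ge0$ and $\sum_{i=1}^K a_i\le T$ there exists $\rho_0>0$ such that $\mathrm{Pr}_f(\mathbf{a}_{\min},\rho)\le \mathrm{Pr}_f(\mathbf{a},\rho)$ for all $0<\rho<\rho_0$.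
   Context: Model. There are $K$ storage nodes $1,\ldots,K$, a source $s$ and a data collector $c$. The channel gains $h_{s,1},\ldots,h_{s,K},h_{1,c},\ldots,h_{K,c}$ are i.i.d. circularly symmetric complex Gaussian with zero mean and unit variance (so the $|h|^2$ are i.i.d. exponential with mean 1). $\rho>0$ is the SNR, $Q>0$ is a fixed rate threshold, and a storage allocation is a vector $\mathbf{a}=(a_1,\ldots,a_K)$ with $a_i\ge 0$ ($a_i$ is the amount of MDS-coded data stored at node $i$; the data object has size 1). Storage phase: the (random) decoding set is $\mathcal{D}=\{i: \log_2(1+\rho|h_{s,i}|^2)\ge Q\}$. Recovery phase: if $\sum_{i\in\mathcal{D}}a_i<1$, recovery fails. If $\sum_{i\in\mathcal{D}}a_i\ge 1$, the collector, knowing the channel gains, chooses time fractions $(t_i)_{i\in\mathcal{D}}$ maximizing $\sum_{i\in\mathcal{D}}t_i\log_2(1+\rho|h_{i,c}|^2)$ subject to $0\le t_i\le a_i$ and $\sum_{i\in\mathcal{D}}t_i=1$; recovery succeeds if this maximum is $>Q$ and fails otherwise. The recovery failure probability is $\mathrm{Pr}_f(\mathbf{a},\rho)$, the probability that recovery fails. A node $i$ is called a complete storage node if $a_i\ge1$; a node with $0<a_i<1$ is called incomplete. "Low SNR regime" means: for all sufficiently small $\rho>0$. *)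

theory Defs
  imports "HOL-Probability.Probability"
begin

text \<open>The circularly symmetric complex Gaussian law with mean 0 and variance 1
  (so that the expectation of \<open>(cmod X)\<^sup>2\<close> is 1), given by its density on the complex plane.\<close>

definition std_complex_gaussian :: "'w measure \<Rightarrow> ('w \<Rightarrow> complex) \<Rightarrow> bool" where
  "std_complex_gaussian M X \<longleftrightarrow>
     distributed M lborel X (\<lambda>z. ennreal (exp (- (cmod z)\<^sup>2) / pi))"

text \<open>\<open>hs i\<close> is the gain from the source to node \<open>i\<close>, and \<open>hc i\<close> the gain from node \<open>i\<close> to the
  collector. The sum type makes all \<open>2 * K\<close> gains one jointly independent family.\<close>

definition iid_gaussian_gains ::
    "'w measure \<Rightarrow> nat \<Rightarrow> (nat \<Rightarrow> 'w \<Rightarrow> complex) \<Rightarrow> (nat \<Rightarrow> 'w \<Rightarrow> complex) \<Rightarrow> bool" where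
  "iid_gaussian_gains M K hs hc \<longleftrightarrow>
     prob_space M \<and>
     prob_space.indep_vars M (\<lambda>_. borel) (case_sum hs hc) ({1..K} <+> {1..K}) \<and>
     (\<forall>i\<in>{1..K}. std_complex_gaussian M (hs i) \<and> std_complex_gaussian M (hc i))"

definition link_rate :: "real \<Rightarrow> complex \<Rightarrow> real" where
  "link_rate \<rho> h = log 2 (1 + \<rho> * (cmod h)\<^sup>2)"

definition decoding_set ::
    "nat \<Rightarrow> real \<Rightarrow> (nat \<Rightarrow> 'w \<Rightarrow> complex) \<Rightarrow> real \<Rightarrow> 'w \<Rightarrow> nat set" where
  "decoding_set K Q hs \<rho> \<omega> = {i \<in> {1..K}. link_rate \<rho> (hs i \<omega>) \<ge> Q}"

definition feasible_fractions :: "nat set \<Rightarrow> (nat \<Rightarrow> real) \<Rightarrow> (nat \<Rightarrow> real) set" where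
  "feasible_fractions D a = {t. (\<forall>i\<in>D. 0 \<le> t i \<and> t i \<le> a i) \<and> (\<Sum>i\<in>D. t i) = 1}"

text \<open>The supremum is only used for \<open>(\<Sum>i\<in>D. a i) \<ge> 1\<close>; the feasible set, restricted to \<open>D\<close>, is then
  a nonempty compact polytope, so the supremum is the maximum.\<close>

definition max_recovery_rate ::
    "nat set \<Rightarrow> (nat \<Rightarrow> real) \<Rightarrow> real \<Rightarrow> (nat \<Rightarrow> complex) \<Rightarrow> real" where
  "max_recovery_rate D a \<rho> h =
     (SUP t\<in>feasible_fractions D a. \<Sum>i\<in>D. t i * link_rate \<rho> (h i))"

definition recovery_succeeds ::
    "nat \<Rightarrow> real \<Rightarrow> (nat \<Rightarrow> 'w \<Rightarrow> complex) \<Rightarrow> (nat \<Rightarrow> 'w \<Rightarrow> complex) \<Rightarrow>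
     (nat \<Rightarrow> real) \<Rightarrow> real \<Rightarrow> 'w \<Rightarrow> bool" where
  "recovery_succeeds K Q hs hc a \<rho> \<omega> \<longleftrightarrow>
     (let D = decoding_set K Q hs \<rho> \<omega> in
        (\<Sum>i\<in>D. a i) \<ge> 1 \<and> max_recovery_rate D a \<rho> (\<lambda>i. hc i \<omega>) > Q)"

definition failure_prob ::
    "'w measure \<Rightarrow> nat \<Rightarrow> real \<Rightarrow> (nat \<Rightarrow> 'w \<Rightarrow> complex) \<Rightarrow> (nat \<Rightarrow> 'w \<Rightarrow> complex) \<Rightarrow>
     (nat \<Rightarrow> real) \<Rightarrow> real \<Rightarrow> real" where
  "failure_prob M K Q hs hc a \<rho> =
     measure M {\<omega> \<in> space M. \<not> recovery_succeeds K Q hs hc a \<rho> \<omega>}"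

definition allocation_within :: "nat \<Rightarrow> real \<Rightarrow> (nat \<Rightarrow> real) \<Rightarrow> bool" where
  "allocation_within K T a \<longleftrightarrow> (\<forall>i\<in>{1..K}. a i \<ge> 0) \<and> (\<Sum>i=1..K. a i) \<le> T"

text \<open>\<open>C\<close> is the set of complete nodes; which nodes are chosen is left open.\<close>

definition min_allocation :: "nat \<Rightarrow> real \<Rightarrow> (nat \<Rightarrow> real) \<Rightarrow> bool" where
  "min_allocation K T a \<longleftrightarrow>
     (\<exists>C\<subseteq>{1..K}. int (card C) = \<lfloor>T\<rfloor> \<and> (\<forall>i\<in>C. a i = 1) \<and>
        (if T \<in> \<int> then \<forall>i\<in>{1..K} - C. a i = 0
         else \<exists>j\<in>{1..K} - C. a j = T - \<lfloor>T\<rfloor> \<and> (\<forall>i\<in>{1..K} - C - {j}. a i = 0)))"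

lemma min_allocation_exists:
  assumes "T > 0" and "int K \<ge> \<lceil>T\<rceil>"
  shows "\<exists>a. min_allocation K T a"
proof -
  define n where "n = nat \<lfloor>T\<rfloor>"
  have n: "int n = \<lfloor>T\<rfloor>" using assms by (simp add: n_def)
  define a :: "nat \<Rightarrow> real" where
    "a = (\<lambda>i. if i \<le> n then 1 else if i = Suc n then T - \<lfloor>T\<rfloor> else 0)"
  have le: "n \<le> K" using n assms(2) floor_le_ceiling[of T] by linarith
  have frac: "Suc n \<le> K" if "T \<notin> \<int>"
    using that n assms(2) by (simp add: ceiling_altdef Ints_def split: if_splits)
  have int: "T - \<lfloor>T\<rfloor> = 0" if "T \<in> \<int>"
    using that by (auto elim: Ints_cases)
  have "min_allocation K T a"
    unfolding min_allocation_def
  proof (intro exI[of _ "{1..n}"] conjI)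
    show "if T \<in> \<int> then \<forall>i\<in>{1..K} - {1..n}. a i = 0
      else \<exists>j\<in>{1..K} - {1..n}. a j = T - \<lfloor>T\<rfloor> \<and> (\<forall>i\<in>{1..K} - {1..n} - {j}. a i = 0)"
    proof (cases "T \<in> \<int>")
      case True
      then show ?thesis using int by (auto simp: a_def)
    next
      case False
      then show ?thesis using frac by (auto simp: a_def intro!: bexI[of _ "Suc n"])
    qed
  qed (use n le in \<open>auto simp: a_def\<close>)
  then show ?thesis by blast
qed

end

theory Submission
  imports Defs
begin

text \<open>Put \<open>A = 2 powr Q\<close> and let \<open>p = exp (- (A - 1) / \<rho>)\<close> be the probability that a single link
  supports the rate \<open>Q\<close>; it tends to 0 with \<open>\<rho>\<close>. A complete node alone recovers the object with
  probability \<open>p\<^sup>2\<close>, and a success in which no decoding complete node has a good link to the collector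
  needs at least two decoding nodes and one link to the collector of rate above \<open>Q\<close>, so it has
  probability \<open>O(p\<^sup>3)\<close>. Hence an allocation with fewer than \<open>\<lfloor>T\<rfloor>\<close> complete nodes loses.

  With exactly \<open>\<lfloor>T\<rfloor>\<close> complete nodes, the remaining budget \<open>r < 1\<close> only helps next to a decoding
  complete node whose rate to the collector is at most \<open>Q\<close>. Let \<open>H s\<close> be the probability that such a
  node together with an incomplete node of size \<open>s\<close> reaches the rate \<open>Q\<close>, given that both decode. If
  two or more incomplete nodes decode, pooling the budget at the best of them can only help, so these
  events cost at most a further factor \<open>O(p)\<close> against \<open>H r\<close>. It remains to see that
  \<open>(\<Sum>i. H (a i)) \<le> \<theta> * H r\<close> for some \<open>\<theta> < 1\<close> if at least two sizes \<open>a i\<close> add up to at most \<open>r\<close>. This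
  follows from \<open>H s \<le> \<theta> * (s / r) * H r\<close> for \<open>s < r\<close> and small \<open>\<rho>\<close>, which is a Laplace-type estimate of
  the integral representing \<open>H s\<close>. An allocation with at most one incomplete node is, up to a
  permutation of the nodes, dominated pointwise by the optimal one.\<close>

section \<open>The failure exponent of a complete and an incomplete node\<close>

text \<open>If the complete node has gain \<open>x\<close> and \<open>L = 1 + \<rho> * x \<le> A\<close>, then the pair reaches the rate \<open>Q\<close> iff
  the gain \<open>y\<close> of the incomplete node of size \<open>s\<close> satisfies \<open>1 + \<rho> * y > A * (A / L) powr (1 / s - 1)\<close>. The
  density \<open>exp (- x)\<close> times the tail \<open>exp (- y)\<close> at this threshold is
  \<open>exp (- (exponent A s L - 2) / \<rho>)\<close>.\<close>

definition exponent :: "real \<Rightarrow> real \<Rightarrow> real \<Rightarrow> real" where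
  "exponent A s L = L + A * (A / L) powr (1 / s - 1)"

definition pair_prob :: "real \<Rightarrow> real \<Rightarrow> real \<Rightarrow> real" where
  "pair_prob A s \<rho> = integral {1..A} (\<lambda>L. exp (- (exponent A s L - 2) / \<rho>)) / \<rho>"

section \<open>Convexity-type bounds and monotonicity of the exponent near
  \<open>L = A\<close>\<close>

lemma exponent_at_end: "A > 0 \<Longrightarrow> exponent A s A = 2 * A"
  by (simp add: exponent_def)

text \<open>The lower bound is the tangent line at \<open>L = A\<close>, where the exponent has
  slope \<open>2 - 1 / s\<close>. It comes from ln x \<le> x - 1 followed by 1 + x \<le> exp x;
  \<open>s \<le> 1\<close> makes the power \<open>1 / s - 1\<close> nonnegative, so that the first
  inequality can be scaled by it.\<close>

lemma exponent_tangent_le: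
  assumes "0 < L" "L \<le> A" "0 < s" "s \<le> 1"
  shows "2 * A + (1 / s - 2) * (A - L) \<le> exponent A s L"
proof -
  let ?b = "1 / s - 1"
  have b: "?b \<ge> 0" using assms by simp
  have "ln (L / A) \<le> L / A - 1" using assms by (intro ln_le_minus_one) auto
  hence "ln (A / L) \<ge> 1 - L / A" using assms by (simp add: ln_div)
  hence "?b * (1 - L / A) \<le> ?b * ln (A / L)" using b by (rule mult_left_mono)
  also have "1 + \<dots> \<le> exp (?b * ln (A / L))" by (rule exp_ge_add_one_self)
  also have "\<dots> = (A / L) powr ?b" using assms by (simp add: powr_def)
  finally have "A * (1 + ?b * (1 - L / A)) \<le> A * (A / L) powr ?b"
    using assms by (intro mult_left_mono) auto
  moreover have "A * (1 + ?b * (1 - L / A)) = A + ?b * (A - L)"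
    using assms by (simp add: field_simps)
  ultimately have "A + ?b * (A - L) \<le> A * (A / L) powr ?b" by linarith
  moreover have "(1 / s - 2) * (A - L) = ?b * (A - L) - (A - L)" by (simp add: algebra_simps)
  ultimately show ?thesis unfolding exponent_def by linarith
qed

lemma exponent_has_derivative:
  assumes "0 < L" "0 < A"
  shows "(exponent A s has_real_derivative 1 - (1 / s - 1) * (A / L) powr (1 / s)) (at L)"
proof -
  have "((\<lambda>L. L + A * (A / L) powr (1 / s - 1)) has_real_derivative
     1 - A * ((1 / s - 1) * (A / L) powr (1 / s - 2) * (A / L\<^sup>2))) (at L)"
    using assms by (auto intro!: derivative_eq_intros simp: field_simps power2_eq_square)
  moreover have "A * ((1 / s - 1) * (A / L) powr (1 / s - 2) * (A / L\<^sup>2)) =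
      (1 / s - 1) * (A / L) powr (1 / s)"
  proof -
    have "(A / L) powr (1 / s) = (A / L) powr (1 / s - 2) * (A / L) powr 2"
      by (simp flip: powr_add)
    also have "(A / L) powr 2 = A\<^sup>2 / L\<^sup>2" using assms
      by (simp add: power_divide)
    finally show ?thesis by (simp add: power2_eq_square)
  qed
  ultimately show ?thesis by (simp add: exponent_def[abs_def])
qed

lemma continuous_on_exponent:
  assumes "A > 0" shows "continuous_on {0<..} (exponent A s)"
  using assms
  by (intro DERIV_continuous_on[OF has_field_derivative_at_within[OF exponent_has_derivative]]) auto

text \<open>A converse to the tangent bound, valid only just left of \<open>A\<close>: since
  \<open>m\<close> exceeds \<open>1 / r - 2\<close>, the function \<open>g\<close> has positive
  derivative at \<open>A\<close> and so lies below \<open>g A\<close> there. The bound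
  \<open>\<eta> < A - 1\<close> keeps the interval inside \<open>{1..A}\<close>.\<close>

lemma exponent_near_end:
  assumes "A > 1" "1 / r - 2 < m"
  obtains \<eta> where "0 < \<eta>" "\<eta> < A - 1"
    "\<And>L. A - \<eta> \<le> L \<Longrightarrow> L \<le> A \<Longrightarrow> exponent A r L \<le> 2 * A + m * (A - L)"
proof -
  define g where "g L = exponent A r L + m * L" for L
  have "(g has_real_derivative (1 - (1 / r - 1) * (A / A) powr (1 / r) + m)) (at A)"
    unfolding g_def[abs_def]
    by (rule derivative_eq_intros exponent_has_derivative refl | use assms in simp)+
  hence "(g has_real_derivative (m - (1 / r - 2))) (at A)" using assms by (simp add: algebra_simps)
  from DERIV_pos_inc_left[OF this] assms obtain d where d: "d > 0"
    "\<And>h. 0 < h \<Longrightarrow> h < d \<Longrightarrow> g (A - h) < g A" by auto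
  show ?thesis
  proof (rule that[of "min (d / 2) ((A - 1) / 2)"])
    fix L assume L: "A - min (d / 2) ((A - 1) / 2) \<le> L" "L \<le> A"
    have "g L \<le> g A"
    proof (cases "L = A")
      case False
      thus ?thesis using d(2)[of "A - L"] L d(1) assms by (fastforce simp: min_def field_simps split: if_splits)
    qed auto
    thus "exponent A r L \<le> 2 * A + m * (A - L)"
      using exponent_at_end[of A r] assms unfolding g_def by (simp add: algebra_simps)
  qed (use d assms in \<open>auto simp: min_less_iff_disj\<close>)
qed

lemma exponent_strict_antimono:
  assumes "0 < s" "s < r" "0 < L" "L < A"
  shows "exponent A r L < exponent A s L"
proof -
  have "1 / r < 1 / s" using assms by (simp add: frac_less2)
  hence "(A / L) powr (1 / r - 1) < (A / L) powr (1 / s - 1)"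
    using assms by (intro powr_less_mono) auto
  thus ?thesis using assms unfolding exponent_def by simp
qed

section \<open>Laplace estimates of the pair probability\<close>

lemma pair_prob_integrable:
  assumes "c \<ge> 1" "A > 0"
  shows "(\<lambda>L. exp (- (exponent A s L - 2) / \<rho>)) integrable_on {c..d}"
\<comment> \<open>For \<open>\<rho> = 0\<close> the quotient is 0 by convention and the integrand is
  constant, so no sign condition on \<open>\<rho>\<close> has to be carried along.\<close>
proof (cases "\<rho> = 0")
  case False
  thus ?thesis
  by (intro integrable_continuous_interval continuous_intros
       continuous_on_subset[OF continuous_on_exponent]) (use assms in auto)
qed (simp add: integrable_const_ivl)

text \<open>The model integral for both Laplace bounds. The factor
  \<open>(exp (- (A - 1) / \<rho>))\<^sup>2\<close>, which is p^2, is the value of the integrand at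
  \<open>L = A\<close>; the last factor accounts for cutting off at \<open>c\<close>.\<close>

lemma integral_exp_affine:
  fixes A :: real
  assumes "m > 0" "\<rho> > 0" "c \<le> A"
  shows "((\<lambda>L. exp (- (2 * A + m * (A - L) - 2) / \<rho>)) has_integral
     \<rho> * (exp (- (A - 1) / \<rho>))\<^sup>2 / m * (1 - exp (- m * (A - c) / \<rho>))) {c..A}"
proof -
  define F :: "real \<Rightarrow> real" where "F L = \<rho> / m * exp (- (2 * A + m * (A - L) - 2) / \<rho>)" for L
  have "((\<lambda>L. exp (- (2 * A + m * (A - L) - 2) / \<rho>)) has_integral F A - F c) {c..A}"
    unfolding F_def
    by (intro fundamental_theorem_of_calculus)
       (use assms in \<open>auto intro!: derivative_eq_intros
          simp flip: has_real_derivative_iff_has_vector_derivative\<close>)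
  moreover have "F A - F c = \<rho> * (exp (- (A - 1) / \<rho>))\<^sup>2 / m * (1 - exp (- m * (A - c) / \<rho>))"
  proof -
    have 1: "(exp (- (A - 1) / \<rho>))\<^sup>2 = exp (- (2 * A - 2) / \<rho>)"
      by (simp flip: exp_double)
    have "exp (- (2 * A + m * (A - c) - 2) / \<rho>) = exp (- (2 * A - 2) / \<rho>) * exp (- m * (A - c) / \<rho>)"
      using assms by (simp flip: exp_add) (simp add: field_simps)
    thus ?thesis using assms unfolding F_def 1 by (simp add: right_diff_distrib diff_divide_distrib)
  qed
  ultimately show ?thesis by simp
qed

lemma pair_prob_nonneg: "\<rho> > 0 \<Longrightarrow> A > 0 \<Longrightarrow> 0 \<le> pair_prob A s \<rho>"
  unfolding pair_prob_def
  by (intro divide_nonneg_pos Henstock_Kurzweil_Integration.integral_nonneg pair_prob_integrable) auto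

text \<open>Replace the exponent by its tangent at \<open>A\<close>. For \<open>s < 1 / 2\<close>
  the rate \<open>1 / s - 2\<close> is positive, so the integrand is at most an exponential that
  peaks at \<open>L = A\<close>; the cutoff factor is at most 1.\<close>

lemma pair_prob_upper:
  assumes "A > 1" "0 < s" "s < 1 / 2" "\<rho> > 0"
  shows "pair_prob A s \<rho> \<le> (exp (- (A - 1) / \<rho>))\<^sup>2 / (1 / s - 2)"
proof -
  let ?m = "1 / s - 2"
  have m: "?m > 0" using assms by (simp add: field_simps)
  have "1 \<le> A" using assms by simp
  note I = integral_exp_affine[OF m \<open>\<rho> > 0\<close> this]
  have "integral {1..A} (\<lambda>L. exp (- (exponent A s L - 2) / \<rho>)) \<le>
      \<rho> * (exp (- (A - 1) / \<rho>))\<^sup>2 / ?m * (1 - exp (- ?m * (A - 1) / \<rho>))"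
  proof (rule has_integral_le[OF integrable_integral[OF pair_prob_integrable] I])
    fix L assume "L \<in> {1..A}"
    hence "2 * A + ?m * (A - L) \<le> exponent A s L" using assms exponent_tangent_le[of L A s] by simp
    thus "exp (- (exponent A s L - 2) / \<rho>) \<le> exp (- (2 * A + ?m * (A - L) - 2) / \<rho>)"
      using \<open>\<rho> > 0\<close> by (simp add: divide_right_mono)
  qed (use assms in auto)
  also have "\<dots> \<le> \<rho> * (exp (- (A - 1) / \<rho>))\<^sup>2 / ?m"
    using m assms by (intro mult_left_le) auto
  finally show ?thesis using assms unfolding pair_prob_def by (simp add: field_simps)
qed

text \<open>Only the part of the integral within \<open>\<eta>\<close> of \<open>A\<close> is kept,
  and there the exponent is replaced by the line that dominates it.\<close>

lemma pair_prob_lower: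
  assumes "A > 1" "m > 0" "\<rho> > 0" "0 < \<eta>" "\<eta> < A - 1"
    "\<And>L. A - \<eta> \<le> L \<Longrightarrow> L \<le> A \<Longrightarrow> exponent A r L \<le> 2 * A + m * (A - L)"
  shows "(exp (- (A - 1) / \<rho>))\<^sup>2 / m * (1 - exp (- m * \<eta> / \<rho>)) \<le> pair_prob A r \<rho>"
proof -
  have cancel: "A - (A - \<eta>) = \<eta>" by simp
  have "A - \<eta> \<le> A" using assms by simp
  note I = integral_exp_affine[OF \<open>m > 0\<close> \<open>\<rho> > 0\<close> this, unfolded cancel]
  have "\<rho> * (exp (- (A - 1) / \<rho>))\<^sup>2 / m * (1 - exp (- m * \<eta> / \<rho>)) \<le>
     integral {A - \<eta>..A} (\<lambda>L. exp (- (exponent A r L - 2) / \<rho>))"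
  proof (rule has_integral_le[OF I integrable_integral[OF pair_prob_integrable]])
    fix L assume "L \<in> {A - \<eta>..A}"
    hence "exponent A r L \<le> 2 * A + m * (A - L)" using assms by simp
    thus "exp (- (2 * A + m * (A - L) - 2) / \<rho>) \<le> exp (- (exponent A r L - 2) / \<rho>)"
      using \<open>\<rho> > 0\<close> by (simp add: divide_right_mono)
  qed (use assms in auto)
  also have "\<dots> \<le> integral {1..A} (\<lambda>L. exp (- (exponent A r L - 2) / \<rho>))"
    by (intro integral_subset_le pair_prob_integrable) (use assms in auto)
  finally show ?thesis using assms unfolding pair_prob_def by (simp add: field_simps)
qed

section \<open>Strict comparison of the pair probabilities of two sizes\<close>

lemma tendsto_exp_neg_div:
  assumes "c > (0::real)"
  shows "((\<lambda>\<rho>. exp (- c / \<rho>)) \<longlongrightarrow> 0) (at_right 0)"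
proof (rule filterlim_compose[OF exp_at_bot])
  have "filterlim (\<lambda>\<rho>. - c * inverse \<rho>) at_bot (at_right 0)"
    using assms by (intro filterlim_tendsto_neg_mult_at_bot[OF tendsto_const _ filterlim_inverse_at_top_right]) auto
  thus "filterlim (\<lambda>\<rho>. - c / \<rho>) at_bot (at_right 0)" by (simp add: field_simps)
qed

text \<open>The two Laplace bounds have the same factor p^2. Up to an exponentially small error
  their quotient is m * s / (1 - 2 * s), which is \<open>\<kappa>\<close> * (s / r) with
  \<open>\<kappa> < 1\<close>. Sizes \<open>r\<close> above one half are included, because only a
  lower bound on \<open>pair_prob A r\<close> is used.\<close>

lemma pair_prob_ratio_small:
  assumes A: "A > 1" and s: "0 < s" "s < r" "r < 1" "s < 1 / 2"
  shows "\<exists>\<theta><1. \<forall>\<^sub>F \<rho> in at_right 0. pair_prob A s \<rho> \<le> \<theta> * (s / r) * pair_prob A r \<rho>"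
proof -
  \<comment> \<open>The slope \<open>m\<close> must be positive, must exceed
    \<open>1 / r - 2\<close> to give a lower bound for \<open>r\<close>, and must stay below
    \<open>(1 - 2 * s) / r\<close> to make \<open>\<kappa> < 1\<close>. Since (1 - 2 * r) / r equals
    1 / r - 2, room for it comes from \<open>s < r\<close> and \<open>s < 1 / 2\<close>.\<close>
  have "max 0 (1 / r - 2) < (1 - 2 * s) / r"
    using s by (auto simp: field_simps)
  then obtain m where m: "max 0 (1 / r - 2) < m" "m < (1 - 2 * s) / r" using dense by blast
  obtain \<eta> where \<eta>: "0 < \<eta>" "\<eta> < A - 1"
    "\<And>L. A - \<eta> \<le> L \<Longrightarrow> L \<le> A \<Longrightarrow> exponent A r L \<le> 2 * A + m * (A - L)"
    using exponent_near_end[of A r m] A m by auto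
  define \<kappa> where "\<kappa> = r * m / (1 - 2 * s)"
  have \<kappa>: "0 < \<kappa>" "\<kappa> < 1" using m s unfolding \<kappa>_def by (auto simp: field_simps)
  \<comment> \<open>The midpoint of \<open>\<kappa>\<close> and 1 leaves room to absorb the cutoff
    factor of the lower bound once its exponential is below
    \<open>1 - \<kappa> / \<theta>\<close>.\<close>
  define \<theta> where "\<theta> = (1 + \<kappa>) / 2"
  have \<theta>: "\<theta> < 1" "0 < \<theta>" "\<kappa> < \<theta>" using \<kappa> by (auto simp: \<theta>_def)
  have "m * \<eta> > 0" using m \<eta> by simp
  have "\<forall>\<^sub>F \<rho> in at_right 0. exp (- (m * \<eta>) / \<rho>) < 1 - \<kappa> / \<theta>"
    by (rule order_tendstoD(2)[OF tendsto_exp_neg_div[OF \<open>m * \<eta> > 0\<close>]])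
       (use \<theta> in \<open>simp add: field_simps\<close>)
  moreover have "\<forall>\<^sub>F \<rho> in at_right (0::real). \<rho> > 0"
    by (simp add: eventually_at_right_less)
  ultimately have "\<forall>\<^sub>F \<rho> in at_right 0. pair_prob A s \<rho> \<le> \<theta> * (s / r) * pair_prob A r \<rho>"
  proof eventually_elim
    case (elim \<rho>)
    let ?p = "(exp (- (A - 1) / \<rho>))\<^sup>2"
    have "pair_prob A s \<rho> \<le> ?p / (1 / s - 2)" using pair_prob_upper A s elim by simp
    also have "\<dots> = \<kappa> * (s / r) * (?p / m)"
      unfolding \<kappa>_def using m s by (simp add: field_simps)
    also have "\<dots> \<le> (\<theta> * (1 - exp (- m * \<eta> / \<rho>))) * (s / r) * (?p / m)"
      by (intro mult_right_mono) (use elim \<theta> m s in \<open>auto simp: field_simps\<close>)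
    also have "\<dots> = \<theta> * (s / r) * (?p / m * (1 - exp (- m * \<eta> / \<rho>)))" by simp
    also have "\<dots> \<le> \<theta> * (s / r) * pair_prob A r \<rho>"
      by (intro mult_left_mono pair_prob_lower) (use elim \<theta> \<eta> m s A in auto)
    finally show ?case .
  qed
  with \<theta> show ?thesis by blast
qed

text \<open>The derivative at \<open>A\<close> is 2 - 1 / r, positive for \<open>r > 1 / 2\<close>,
  and it stays positive nearby by continuity.\<close>

lemma exponent_increasing_near_end:
  assumes A: "A > 1" and r: "1 / 2 < r"
  obtains d where "0 < d" "d < A - 1" "mono_on {A - d..A} (exponent A r)"
proof -
  have "((\<lambda>L. 1 - (1 / r - 1) * (A / L) powr (1 / r)) \<longlongrightarrow> 1 - (1 / r - 1) * (A / A) powr (1 / r)) (at A)"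
    using A by (intro tendsto_intros) auto
  moreover have "1 - (1 / r - 1) * (A / A) powr (1 / r) > 0"
    using A r by (simp add: field_simps)
  ultimately have "\<forall>\<^sub>F L in at A. 1 - (1 / r - 1) * (A / L) powr (1 / r) > 0"
    by (rule order_tendstoD(1))
  then obtain d where d: "d > 0"
    "\<And>L. L \<noteq> A \<Longrightarrow> dist L A < d \<Longrightarrow> 1 - (1 / r - 1) * (A / L) powr (1 / r) > 0"
    unfolding eventually_at by blast
  define e where "e = min (d / 2) ((A - 1) / 2)"
  have e: "0 < e" "e < d" "e < A - 1" using d A by (auto simp: e_def min_less_iff_disj)
  have "mono_on {A - e..A} (exponent A r)"
  proof (rule mono_onI)
    fix x y assume xy: "x \<in> {A - e..A}" "y \<in> {A - e..A}" "x \<le> y"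
    show "exponent A r x \<le> exponent A r y"
    proof (rule DERIV_nonneg_imp_nondecreasing[OF xy(3)])
      fix z assume z: "x \<le> z" "z \<le> y"
      have "1 - (1 / r - 1) * (A / z) powr (1 / r) \<ge> 0"
      proof (cases "z = A")
        case True thus ?thesis using A r by (simp add: field_simps)
      next
        case False thus ?thesis using d(2)[of z] z xy e by (auto simp: dist_real_def)
      qed
      moreover have "z > 0" using z xy e by auto
      ultimately show "\<exists>y. (exponent A r has_real_derivative y) (at z) \<and> 0 \<le> y"
        using exponent_has_derivative[of z A r] A by auto
    qed
  qed
  with that e show ?thesis by blast
qed

text \<open>For \<open>r > 1 / 2\<close> the minimum of \<open>exponent A r\<close> lies strictly below \<open>L = A\<close>. Near \<open>A\<close> it is increasing,
  so the part near \<open>A\<close> carries at most half of the integral; away from \<open>A\<close> the exponent for \<open>s\<close> exceeds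
  the one for \<open>r\<close> by a constant. Since \<open>s / r > 1 / 2\<close>, the bound follows.\<close>

lemma pair_prob_ratio_large:
  assumes A: "A > 1" and s: "1 / 2 \<le> s" "s < r" "r < 1"
  shows "\<exists>\<theta><1. \<forall>\<^sub>F \<rho> in at_right 0. pair_prob A s \<rho> \<le> \<theta> * (s / r) * pair_prob A r \<rho>"
proof -
  obtain d where d: "0 < d" "d < A - 1" "mono_on {A - d..A} (exponent A r)"
    using exponent_increasing_near_end[of A r] A s by auto
  \<comment> \<open>Half of \<open>d\<close>, so that \<open>{A - \<eta>..A}\<close> and its
    translate by \<open>\<eta>\<close> to the left both lie where the exponent for \<open>r\<close>
    is increasing.\<close>
  define \<eta> where "\<eta> = d / 2"
  have \<eta>: "0 < \<eta>" "2 * \<eta> < A - 1" "2 * \<eta> = d" using d by (auto simp: \<eta>_def)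
  \<comment> \<open>The quotient of the two powers of A / L is (A / L)^(1 / s - 1 / r), which on
    \<open>{1..A - \<eta>}\<close> is smallest at the right end; the remaining power of A / L is at
    least 1. This makes \<open>c\<close> a uniform gap.\<close>
  define c where "c = A * ((A / (A - \<eta>)) powr (1 / s - 1 / r) - 1)"
  have sr: "1 / s - 1 / r > 0" using s by (simp add: field_simps)
  have "(A / (A - \<eta>)) powr (1 / s - 1 / r) > 1"
    using \<eta> A sr by (intro gr_one_powr) (auto simp: field_simps)
  hence c: "c > 0" using A by (simp add: c_def)
  have gap: "exponent A s L \<ge> exponent A r L + c" if "1 \<le> L" "L \<le> A - \<eta>" for L
  proof -
    have "(A / (A - \<eta>)) powr (1 / s - 1 / r) \<le> (A / L) powr (1 / s - 1 / r)"
      using that sr A \<eta> by (intro powr_mono2 divide_left_mono) auto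
    moreover have "1 \<le> (A / L) powr (1 / r - 1)"
      using that s A \<eta> by (intro ge_one_powr_ge_zero) (auto simp: field_simps)
    moreover have "(A / (A - \<eta>)) powr (1 / s - 1 / r) > 1" by fact
    ultimately have "1 * ((A / (A - \<eta>)) powr (1 / s - 1 / r) - 1) \<le>
        (A / L) powr (1 / r - 1) * ((A / L) powr (1 / s - 1 / r) - 1)"
      by (intro mult_mono) auto
    also have "\<dots> = (A / L) powr (1 / s - 1) - (A / L) powr (1 / r - 1)"
      by (simp add: right_diff_distrib flip: powr_add)
    finally have "A * ((A / (A - \<eta>)) powr (1 / s - 1 / r) - 1) \<le>
      A * ((A / L) powr (1 / s - 1) - (A / L) powr (1 / r - 1))"
      using A by (intro mult_left_mono) auto
    thus ?thesis unfolding exponent_def c_def by (simp add: right_diff_distrib)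
  qed
  \<comment> \<open>With this choice \<open>\<theta> * (s / r)\<close> is the midpoint of 1 / 2 and
    s / r. It is \<open>\<theta> < 1\<close> because r < 1 \<le> 2 * s.\<close>
  define \<theta> where "\<theta> = (1 + r / (2 * s)) / 2"
  have \<theta>: "\<theta> < 1" "1 / 2 < \<theta> * (s / r)" using s by (auto simp: \<theta>_def field_simps)
  have "\<forall>\<^sub>F \<rho> in at_right 0. exp (- c / \<rho>) < \<theta> * (s / r) - 1 / 2"
    by (rule order_tendstoD(2)[OF tendsto_exp_neg_div[OF c]]) (use \<theta> in simp)
  moreover have "\<forall>\<^sub>F \<rho> in at_right (0::real). \<rho> > 0"
    by (simp add: eventually_at_right_less)
  ultimately have "\<forall>\<^sub>F \<rho> in at_right 0. pair_prob A s \<rho> \<le> \<theta> * (s / r) * pair_prob A r \<rho>"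
  proof eventually_elim
    case (elim \<rho>)
    let ?e = "\<lambda>s L. exp (- (exponent A s L - 2) / \<rho>)"
    have int: "?e u integrable_on {a..b}" if "a \<ge> 1" for u a b
      using pair_prob_integrable[of a A u \<rho> b] that A by simp
    have far: "integral {1..A - \<eta>} (?e s) \<le> exp (- c / \<rho>) * integral {1..A} (?e r)"
    proof -
      have "integral {1..A - \<eta>} (?e s) \<le> integral {1..A - \<eta>} (\<lambda>L. exp (- c / \<rho>) * ?e r L)"
      proof (rule integral_le)
        fix L assume "L \<in> {1..A - \<eta>}"
        hence "- (exponent A s L - 2) / \<rho> \<le> - c / \<rho> + - (exponent A r L - 2) / \<rho>"
          using gap[of L] elim by (simp add: divide_simps)
        thus "?e s L \<le> exp (- c / \<rho>) * ?e r L" by (simp flip: exp_add)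
      qed (intro int integrable_on_mult_right; simp)+
      also have "\<dots> = exp (- c / \<rho>) * integral {1..A - \<eta>} (?e r)" by simp
      also have "\<dots> \<le> exp (- c / \<rho>) * integral {1..A} (?e r)"
        by (intro mult_left_mono integral_subset_le int) (use \<eta> in auto)
      finally show ?thesis .
    qed
    have near: "integral {A - \<eta>..A} (?e s) \<le> 1 / 2 * integral {1..A} (?e r)"
    proof -
      have 1: "integral {A - \<eta>..A} (?e s) \<le> integral {A - \<eta>..A} (?e r)"
      proof (rule integral_le)
        fix L assume L: "L \<in> {A - \<eta>..A}"
        have "exponent A r L \<le> exponent A s L"
          using exponent_strict_antimono[of s r L A] exponent_at_end[of A] L s A \<eta>
          by (cases "L = A") auto
        thus "?e s L \<le> ?e r L" using elim by (simp add: divide_right_mono)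
      qed (intro int; use \<eta> in simp)+
      \<comment> \<open>Translating by \<open>\<eta>\<close> to the left increases the integrand for
        \<open>r\<close>, so the last interval of length \<open>\<eta>\<close> contributes no more
        than the one before it, hence at most half of the whole.\<close>
      have "(?e r has_integral integral {A - 2 * \<eta>..A - \<eta>} (?e r)) (cbox (A - 2 * \<eta>) (A - \<eta>))"
        using int[of "A - 2 * \<eta>" r "A - \<eta>"] \<eta> by (simp add: integrable_integral)
      from has_integral_affinity[OF this, of 1 "- \<eta>"]
      have shifted: "((\<lambda>L. ?e r (L - \<eta>)) has_integral integral {A - 2 * \<eta>..A - \<eta>} (?e r)) {A - \<eta>..A}"
        by (simp add: image_affinity_atLeastAtMost algebra_simps)
      have "integral {A - \<eta>..A} (?e r) \<le> integral {A - \<eta>..A} (\<lambda>L. ?e r (L - \<eta>))"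
      proof (rule integral_le)
        show "(\<lambda>L. ?e r (L - \<eta>)) integrable_on {A - \<eta>..A}"
          using shifted by (rule has_integral_integrable)
        fix L assume L: "L \<in> {A - \<eta>..A}"
        hence "exponent A r (L - \<eta>) \<le> exponent A r L"
          using \<eta> d by (intro mono_onD[OF d(3)]) auto
        thus "?e r L \<le> ?e r (L - \<eta>)" using elim by (simp add: divide_right_mono)
      qed (intro int; use \<eta> in simp)+
      also have "\<dots> = integral {A - 2 * \<eta>..A - \<eta>} (?e r)"
        using shifted by (rule integral_unique)
      finally have "2 * integral {A - \<eta>..A} (?e r) \<le> integral {A - 2 * \<eta>..A} (?e r)"
        using Henstock_Kurzweil_Integration.integral_combine[of "A - 2 * \<eta>" "A - \<eta>" A "?e r"] \<eta>
          int[of "A - 2 * \<eta>" r A] by simp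
      also have "\<dots> \<le> integral {1..A} (?e r)"
        by (intro integral_subset_le int) (use \<eta> in auto)
      finally show ?thesis using 1 by simp
    qed
    have "integral {1..A} (?e s) = integral {1..A - \<eta>} (?e s) + integral {A - \<eta>..A} (?e s)"
      by (rule Henstock_Kurzweil_Integration.integral_combine[symmetric]) (use \<eta> int in auto)
    also have "\<dots> \<le> (exp (- c / \<rho>) + 1 / 2) * integral {1..A} (?e r)"
      using far near by (simp add: ring_distribs)
    also have "\<dots> \<le> \<theta> * (s / r) * integral {1..A} (?e r)"
      by (intro mult_right_mono Henstock_Kurzweil_Integration.integral_nonneg int) (use elim in auto)
    finally have "integral {1..A} (?e s) \<le> \<theta> * (s / r) * integral {1..A} (?e r)" .
    from divide_right_mono[OF this, of \<rho>] elim show ?case unfolding pair_prob_def by simp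
  qed
  with \<theta> show ?thesis by blast
qed

lemma pair_prob_ratio:
  assumes "A > 1" "0 < s" "s < r" "r < 1"
  shows "\<exists>\<theta><1. \<forall>\<^sub>F \<rho> in at_right 0. pair_prob A s \<rho> \<le> \<theta> * (s / r) * pair_prob A r \<rho>"
  using assms pair_prob_ratio_small[of A s r] pair_prob_ratio_large[of A s r] by fastforce

section \<open>Distribution of the gains\<close>

text \<open>Replaces polar coordinates: both sides agree on \<open>{..t}\<close> by the area of the disc of radius \<open>sqrt t\<close>.\<close>

lemma distr_lborel_cmod_sq:
  "distr lborel borel (\<lambda>z::complex. (cmod z)\<^sup>2) = density lborel (\<lambda>x. ennreal (pi * indicator {0..} x))"
proof (rule measure_eqI_generator_eq[where E="range atMost" and \<Omega>=UNIV and A="\<lambda>n. {..real n}"])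
  show "Int_stable (range (atMost :: real \<Rightarrow> real set))"
    by (auto simp: Int_stable_def)
  fix X :: "real set" assume "X \<in> range atMost"
  then obtain t where t: "X = {..t}" by auto
  have "emeasure (distr lborel borel (\<lambda>z::complex. (cmod z)\<^sup>2)) X = emeasure lborel {z::complex. (cmod z)\<^sup>2 \<le> t}"
    unfolding t by (subst emeasure_distr) (auto simp: vimage_def)
  also have "\<dots> = ennreal (if 0 \<le> t then pi * t else 0)"
  proof (cases "0 \<le> t")
    case True
    hence "{z::complex. (cmod z)\<^sup>2 \<le> t} = cball 0 (sqrt t)"
      by (auto simp: real_le_rsqrt) (metis norm_ge_zero power_mono real_sqrt_pow2)
    thus ?thesis using True by (simp add: emeasure_cball unit_ball_vol_2)
  next
    case False
    hence "{z::complex. (cmod z)\<^sup>2 \<le> t} = {}"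
      by (auto simp: not_le) (smt (verit) zero_le_power2)
    thus ?thesis using False by simp
  qed
  also have "\<dots> = (\<integral>\<^sup>+x. ennreal pi * indicator {0..t} x \<partial>lborel)"
    by (subst nn_integral_cmult_indicator) (auto simp: ennreal_mult)
  also have "\<dots> = emeasure (density lborel (\<lambda>x. ennreal (pi * indicator {0..} x))) X"
    unfolding t by (subst emeasure_density) (auto intro!: nn_integral_cong split: split_indicator)
  finally show "emeasure (distr lborel borel (\<lambda>z::complex. (cmod z)\<^sup>2)) X =
      emeasure (density lborel (\<lambda>x. ennreal (pi * indicator {0..} x))) X" .
next
  fix n :: nat
  have "emeasure (distr lborel borel (\<lambda>z::complex. (cmod z)\<^sup>2)) {..real n} = emeasure lborel {z::complex. (cmod z)\<^sup>2 \<le> real n}"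
    by (subst emeasure_distr) (auto simp: vimage_def)
  also have "\<dots> \<le> emeasure lborel (cball 0 (sqrt (real n)) :: complex set)"
    by (intro emeasure_mono) (auto simp: real_le_rsqrt)
  also have "\<dots> < \<infinity>" by (simp add: emeasure_cball)
  finally show "emeasure (distr lborel borel (\<lambda>z::complex. (cmod z)\<^sup>2)) {..real n} \<noteq> \<infinity>" by simp
next
  show "(\<Union>n. {..real n}) = UNIV" using real_arch_simple by auto
qed (auto simp: borel_eq_atMost)

text \<open>The Gaussian density is a function of the squared modulus, so it can be carried through
  the image measure. The image of Lebesgue measure has constant density pi on the half-line, which
  cancels the normalising 1 / pi.\<close>

lemma std_complex_gaussian_sq_exponential:
  assumes "std_complex_gaussian M X"
  shows "distributed M lborel (\<lambda>\<omega>. (cmod (X \<omega>))\<^sup>2) (exponential_density 1)"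
proof -
  have X: "distr M lborel X = density lborel (\<lambda>z. ennreal (exp (- (cmod z)\<^sup>2) / pi))"
    and [measurable]: "X \<in> borel_measurable M"
    using assms unfolding std_complex_gaussian_def distributed_def by auto
  have "distr M lborel (\<lambda>\<omega>. (cmod (X \<omega>))\<^sup>2) = distr (distr M lborel X) borel (\<lambda>z. (cmod z)\<^sup>2)"
    by (subst distr_distr) (auto simp: comp_def intro!: distr_cong)
  also have "\<dots> = density (distr lborel borel (\<lambda>z::complex. (cmod z)\<^sup>2)) (\<lambda>x. ennreal (exp (- x) / pi))"
    unfolding X by (subst density_distr) auto
  also have "\<dots> = density lborel (\<lambda>x. ennreal (pi * indicator {0..} x) * ennreal (exp (- x) / pi))"
    unfolding distr_lborel_cmod_sq by (subst density_density_eq) auto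
  also have "\<dots> = density lborel (\<lambda>x. ennreal (exponential_density 1 x))"
    by (intro density_cong AE_I2)
       (auto simp: exponential_density_def simp flip: ennreal_mult split: split_indicator)
  finally show ?thesis
    unfolding distributed_def by (auto simp: comp_def)
qed

section \<open>Rates and thresholds as conditions on the squared gains\<close>

lemma link_rate_nonneg: "\<rho> > 0 \<Longrightarrow> 0 \<le> link_rate \<rho> h"
  unfolding link_rate_def by (rule zero_le_log_cancel_iff[THEN iffD2]) (auto simp: add_pos_nonneg)

lemma link_rate_ge_iff:
  assumes "\<rho> > 0" shows "Q \<le> link_rate \<rho> h \<longleftrightarrow> (2 powr Q - 1) / \<rho> \<le> (cmod h)\<^sup>2"
proof -
  have "0 < 1 + \<rho> * (cmod h)\<^sup>2" using assms by (simp add: add_pos_nonneg)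
  thus ?thesis using assms unfolding link_rate_def by (subst le_log_iff) (auto simp: field_simps)
qed

lemma link_rate_measurable [measurable]: "link_rate \<rho> \<in> borel_measurable borel"
  unfolding link_rate_def[abs_def] by measurable

text \<open>Solving the rate inequality for \<open>y\<close>: the base-2 logarithm of
  \<open>A * (A / L) powr (1 / s - 1)\<close> is \<open>(Q - (1 - s) * log 2 L) / s\<close>, the
  rate that the incomplete node has to exceed.\<close>

lemma pair_condition_iff:
  fixes x y Q :: real
  assumes "\<rho> > 0" "0 < s" "s \<le> 1" "x \<ge> 0" "y \<ge> 0"
  defines "A \<equiv> 2 powr Q" and "L \<equiv> 1 + \<rho> * x"
  shows "Q < (1 - s) * log 2 L + s * log 2 (1 + \<rho> * y) \<longleftrightarrow>
    (A * (A / L) powr (1 / s - 1) - 1) / \<rho> < y"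
proof -
  have L: "L > 0" and Y: "1 + \<rho> * y > 0" and A: "A > 0" "log 2 A = Q"
    using assms by (auto simp: add_pos_nonneg)
  have "log 2 (A * (A / L) powr (1 / s - 1)) = Q + (1 / s - 1) * (Q - log 2 L)"
    using A L by (simp add: log_mult log_powr log_divide)
  also have "\<dots> = (Q - (1 - s) * log 2 L) / s"
    using assms by (simp add: field_simps)
  finally have *: "log 2 (A * (A / L) powr (1 / s - 1)) = (Q - (1 - s) * log 2 L) / s" .
  have "Q < (1 - s) * log 2 L + s * log 2 (1 + \<rho> * y) \<longleftrightarrow>
     (Q - (1 - s) * log 2 L) / s < log 2 (1 + \<rho> * y)"
    using assms by (simp add: field_simps)
  also have "\<dots> \<longleftrightarrow> A * (A / L) powr (1 / s - 1) < 1 + \<rho> * y"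
    unfolding *[symmetric] using A L Y by (subst log_less_cancel_iff) auto
  also have "\<dots> \<longleftrightarrow> (A * (A / L) powr (1 / s - 1) - 1) / \<rho> < y"
    using assms by (simp add: field_simps)
  finally show ?thesis .
qed

lemma nn_integral_exponential_tail:
  assumes "0 \<le> t"
  shows "(\<integral>\<^sup>+y. ennreal (exponential_density 1 y) * indicator {t<..} y \<partial>lborel) = ennreal (exp (- t))"
proof -
  interpret E: prob_space "density lborel (exponential_density 1)"
    by (rule prob_space_exponential_density) simp
  have "distributed (density lborel (exponential_density 1)) lborel (\<lambda>x. x) (exponential_density 1)"
    unfolding distributed_def by (auto simp: distr_id2)
  from E.exponential_distributedD_gt[OF this assms]
  have "E.prob {t<..} = exp (- t)"
    by (simp add: greaterThan_def)
  hence "emeasure (density lborel (exponential_density 1)) {t<..} = ennreal (exp (- t))"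
    by (simp add: E.emeasure_eq_measure)
  thus ?thesis by (subst (asm) emeasure_density) auto
qed

text \<open>Apply independence of disjoint blocks to the singletons \<open>{f j}\<close>, which are
  disjoint by injectivity, then read off the single coordinate. This serves both to extract two
  gains and to permute the nodes.\<close>

lemma (in prob_space) indep_vars_reindex:
  assumes "indep_vars M' X I" "inj_on f J" "f ` J \<subseteq> I"
  shows "indep_vars (\<lambda>j. M' (f j)) (\<lambda>j. X (f j)) J"
proof -
  have "indep_vars (\<lambda>j. PiM {f j} M') (\<lambda>j \<omega>. restrict (\<lambda>i. X i \<omega>) {f j}) J"
    by (rule indep_vars_restrict[OF assms(1)])
       (use assms in \<open>auto simp: disjoint_family_on_def inj_on_def\<close>)
  from indep_vars_compose2[OF this, of "\<lambda>j x. x (f j)" "\<lambda>j. M' (f j)"]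
  show ?thesis by simp
qed

section \<open>Tail and pair probabilities of the gains\<close>

locale iid_gains = prob_space M for M :: "'w measure" +
  fixes K :: nat and hs hc :: "nat \<Rightarrow> 'w \<Rightarrow> complex"
  assumes gains: "iid_gaussian_gains M K hs hc"
begin

lemma indep: "indep_vars (\<lambda>_. borel) (case_sum hs hc) ({1..K} <+> {1..K})"
  and gaussian: "i \<in> {1..K} \<Longrightarrow> std_complex_gaussian M (hs i)" "i \<in> {1..K} \<Longrightarrow> std_complex_gaussian M (hc i)"
  using gains unfolding iid_gaussian_gains_def by auto

lemma gain_measurable [measurable (raw)]:
  "i \<in> {1..K} \<Longrightarrow> hs i \<in> borel_measurable M" "i \<in> {1..K} \<Longrightarrow> hc i \<in> borel_measurable M"
  using gaussian unfolding std_complex_gaussian_def distributed_def by auto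

text \<open>The law has a density, so the boundary point is null and both tails agree. The closed
  tail is the decoding condition, the open tail the condition that recovery exceeds
  \<open>Q\<close>.\<close>

lemma prob_tail:
  assumes "std_complex_gaussian M X" "0 \<le> w"
  shows "prob {\<omega> \<in> space M. w \<le> (cmod (X \<omega>))\<^sup>2} = exp (- w)"
    and "prob {\<omega> \<in> space M. w < (cmod (X \<omega>))\<^sup>2} = exp (- w)"
proof -
  note D = std_complex_gaussian_sq_exponential[OF assms(1)]
  show *: "prob {\<omega> \<in> space M. w < (cmod (X \<omega>))\<^sup>2} = exp (- w)"
    using exponential_distributedD_gt[OF D assms(2)] by simp
  have "emeasure M ((\<lambda>\<omega>. (cmod (X \<omega>))\<^sup>2) -` {w..} \<inter> space M) =
        emeasure M ((\<lambda>\<omega>. (cmod (X \<omega>))\<^sup>2) -` {w<..} \<inter> space M)"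
    by (subst (1 2) distributed_emeasure[OF D])
       (auto intro!: nn_integral_cong_AE AE_mp[OF AE_lborel_singleton[of w] AE_I2] split: split_indicator)
  hence "prob {\<omega> \<in> space M. w \<le> (cmod (X \<omega>))\<^sup>2} = prob {\<omega> \<in> space M. w < (cmod (X \<omega>))\<^sup>2}"
    unfolding measure_def by (simp add: vimage_def Int_def conj_commute)
  with * show "prob {\<omega> \<in> space M. w \<le> (cmod (X \<omega>))\<^sup>2} = exp (- w)" by simp
qed

text \<open>By independence the two squared gains have a product density. The inner integral over
  \<open>y\<close> is an exponential tail at the threshold, and the substitution
  \<open>L = 1 + \<rho> * x\<close> turns the outer one into \<open>pair_prob\<close>.\<close>

lemma prob_pair:
  assumes c: "c \<in> {1..K}" and i: "i \<in> {1..K}" and "c \<noteq> i"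
    and \<rho>: "\<rho> > 0" and Q: "Q > 0" and s: "0 < s" "s \<le> 1"
  shows "prob {\<omega> \<in> space M. link_rate \<rho> (hc c \<omega>) \<le> Q \<and>
      Q < (1 - s) * link_rate \<rho> (hc c \<omega>) + s * link_rate \<rho> (hc i \<omega>)} = pair_prob (2 powr Q) s \<rho>"
proof -
  define A where "A = 2 powr Q"
  have A: "A > 1" using Q unfolding A_def by simp
  define \<theta> where "\<theta> x = (A * (A / (1 + \<rho> * x)) powr (1 / s - 1) - 1) / \<rho>" for x
  have \<theta>_meas [measurable]: "\<theta> \<in> borel_measurable borel" unfolding \<theta>_def[abs_def] by measurable
  define w where "w = (A - 1) / \<rho>"
  let ?X = "\<lambda>\<omega>. (cmod (hc c \<omega>))\<^sup>2" and ?Y = "\<lambda>\<omega>. (cmod (hc i \<omega>))\<^sup>2"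
  let ?f = "exponential_density 1"
  have "indep_var borel (hc c) borel (hc i)"
  proof -
    \<comment> \<open>Independence of two variables is independence of a family indexed by the
      Booleans.\<close>
    have "indep_vars (\<lambda>b. borel) (\<lambda>b. case_sum hs hc (if b then Inr c else Inr i)) UNIV"
      by (rule indep_vars_reindex[OF indep]) (use c i \<open>c \<noteq> i\<close> in \<open>auto simp: inj_on_def\<close>)
    moreover have "(\<lambda>b. case_sum hs hc (if b then Inr c else Inr i)) = case_bool (hc c) (hc i)"
      by (auto split: bool.split)
    moreover have "(\<lambda>b. borel) = case_bool borel borel" by (auto split: bool.split)
    ultimately show ?thesis unfolding indep_var_def by metis
  qed
  hence ind: "indep_var lborel ?X lborel ?Y"
    by (rule indep_var_compose[unfolded comp_def]) auto
  note DX = std_complex_gaussian_sq_exponential[OF gaussian(2)[OF c]]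
  note DY = std_complex_gaussian_sq_exponential[OF gaussian(2)[OF i]]
  have D: "distributed M (lborel \<Otimes>\<^sub>M lborel) (\<lambda>\<omega>. (?X \<omega>, ?Y \<omega>)) (\<lambda>(x, y). ennreal (?f x) * ennreal (?f y))"
    by (rule distributed_joint_indep[OF _ _ DX DY ind]) (auto simp: lborel.sigma_finite_measure_axioms)
  let ?S = "{(x, y). x \<le> w \<and> \<theta> x < y}"
  have S [measurable]: "?S \<in> sets (lborel \<Otimes>\<^sub>M lborel)"
  proof -
    have "{z \<in> space (lborel \<Otimes>\<^sub>M lborel). fst z \<le> w \<and> \<theta> (fst z) < snd z} \<in> sets (lborel \<Otimes>\<^sub>M lborel)"
      by measurable
    also have "{z \<in> space (lborel \<Otimes>\<^sub>M lborel). fst z \<le> w \<and> \<theta> (fst z) < snd z} = ?S"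
      by (auto simp: space_pair_measure)
    finally show ?thesis .
  qed
  have "emeasure M {\<omega> \<in> space M. link_rate \<rho> (hc c \<omega>) \<le> Q \<and>
      Q < (1 - s) * link_rate \<rho> (hc c \<omega>) + s * link_rate \<rho> (hc i \<omega>)} =
    emeasure M ((\<lambda>\<omega>. (?X \<omega>, ?Y \<omega>)) -` ?S \<inter> space M)"
  proof (rule arg_cong[where f = "emeasure M"], intro set_eqI)
    fix \<omega>
    have "link_rate \<rho> (hc c \<omega>) \<le> Q \<longleftrightarrow> ?X \<omega> \<le> w"
    proof -
      have "0 < 1 + \<rho> * ?X \<omega>" using \<rho> by (simp add: add_pos_nonneg)
      thus ?thesis using \<rho> unfolding link_rate_def w_def A_def by (subst log_le_iff) (auto simp: field_simps)
    qed
    moreover have "Q < (1 - s) * link_rate \<rho> (hc c \<omega>) + s * link_rate \<rho> (hc i \<omega>) \<longleftrightarrow> \<theta> (?X \<omega>) < ?Y \<omega>"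
      unfolding link_rate_def \<theta>_def A_def by (rule pair_condition_iff) (use \<rho> s in auto)
    ultimately show "(\<omega> \<in> {\<omega> \<in> space M. link_rate \<rho> (hc c \<omega>) \<le> Q \<and>
      Q < (1 - s) * link_rate \<rho> (hc c \<omega>) + s * link_rate \<rho> (hc i \<omega>)}) \<longleftrightarrow>
      \<omega> \<in> (\<lambda>\<omega>. (?X \<omega>, ?Y \<omega>)) -` ?S \<inter> space M" by auto
  qed
  also have "\<dots> = (\<integral>\<^sup>+z. (case z of (x, y) \<Rightarrow> ennreal (?f x) * ennreal (?f y)) * indicator ?S z \<partial>(lborel \<Otimes>\<^sub>M lborel))"
    by (rule distributed_emeasure[OF D S])
  also have "\<dots> = (\<integral>\<^sup>+x. \<integral>\<^sup>+y. ennreal (?f x) * ennreal (?f y) * indicator ?S (x, y) \<partial>lborel \<partial>lborel)"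
    by (subst lborel.nn_integral_fst[symmetric]) auto
  also have "\<dots> = (\<integral>\<^sup>+x. ennreal (exp (- (exponent A s (1 + \<rho> * x) - 2) / \<rho>)) * indicator {1..A} (1 + \<rho> * x) \<partial>lborel)"
  proof (rule nn_integral_cong)
    fix x :: real
    show "(\<integral>\<^sup>+y. ennreal (?f x) * ennreal (?f y) * indicator ?S (x, y) \<partial>lborel) =
      ennreal (exp (- (exponent A s (1 + \<rho> * x) - 2) / \<rho>)) * indicator {1..A} (1 + \<rho> * x)"
    proof (cases "0 \<le> x \<and> x \<le> w")
      case True
      define L where "L = 1 + \<rho> * x"
      have L: "1 \<le> L" "L \<le> A" using True \<rho> by (auto simp: L_def w_def field_simps)
      \<comment> \<open>The tail formula requires a nonnegative threshold. Here
        \<open>L \<le> A\<close>, that is the bad link of the complete node, and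
        \<open>s \<le> 1\<close> put \<open>1 + \<rho> * \<theta> x\<close> at or above
        \<open>A\<close>, hence above 1.\<close>
      have "A * 1 \<le> A * (A / L) powr (1 / s - 1)"
        using A L s by (intro mult_left_mono ge_one_powr_ge_zero) (auto simp: field_simps)
      hence "1 \<le> A * (A / L) powr (1 / s - 1)" using A by linarith
      hence \<theta>: "0 \<le> \<theta> x" using \<rho> unfolding \<theta>_def L_def[symmetric] by simp
      have "(\<integral>\<^sup>+y. ennreal (?f x) * ennreal (?f y) * indicator ?S (x, y) \<partial>lborel) =
        (\<integral>\<^sup>+y. ennreal (?f x) * (ennreal (?f y) * indicator {\<theta> x<..} y) \<partial>lborel)"
        using True by (intro nn_integral_cong) (auto split: split_indicator)
      also have "\<dots> = ennreal (?f x) * ennreal (exp (- \<theta> x))"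
        by (subst nn_integral_cmult) (auto simp: nn_integral_exponential_tail[OF \<theta>])
      also have "\<dots> = ennreal (exp (- x + - \<theta> x))"
        unfolding exp_add using True by (subst ennreal_mult) (auto simp: exponential_density_def)
      also have "- x + - \<theta> x = - (exponent A s L - 2) / \<rho>"
        using \<rho> by (simp add: exponent_def \<theta>_def L_def field_simps)
      finally show ?thesis using L unfolding L_def by simp
    next
      case False
      have "(\<integral>\<^sup>+y. ennreal (?f x) * ennreal (?f y) * indicator ?S (x, y) \<partial>lborel) = (\<integral>\<^sup>+(y::real). 0 \<partial>lborel)"
        using False by (intro nn_integral_cong) (auto simp: exponential_density_def split: split_indicator)
      moreover have "1 + \<rho> * x \<notin> {1..A}"
        using False \<rho> by (auto simp: w_def field_simps zero_le_mult_iff)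
      ultimately show ?thesis by simp
    qed
  qed
  also have "\<dots> = ennreal (pair_prob A s \<rho>)"
  proof -
    let ?g = "\<lambda>L. exp (- (exponent A s L - 2) / \<rho>)"
    have g: "(\<lambda>L. ennreal (?g L) * indicator {1..A} L) \<in> borel_measurable borel"
      unfolding exponent_def by measurable
    have I: "(?g has_integral integral {1..A} ?g) {1..A}"
      using pair_prob_integrable[of 1 A] A by (intro integrable_integral) auto
    have "ennreal (integral {1..A} ?g) = (\<integral>\<^sup>+L. ennreal (?g L) * indicator {1..A} L \<partial>lborel)"
      using nn_integral_has_integral_lebesgue'[OF _ I] by simp
    \<comment> \<open>The affine change of variables produces the factor \<open>\<rho>\<close> by
      which \<open>pair_prob\<close> divides.\<close>
    also have "\<dots> = ennreal \<rho> * (\<integral>\<^sup>+x. ennreal (?g (1 + \<rho> * x)) * indicator {1..A} (1 + \<rho> * x) \<partial>lborel)"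
      using nn_integral_real_affine[OF g, of \<rho> 1] \<rho> by simp
    finally have "ennreal (1 / \<rho>) * ennreal (integral {1..A} ?g) = ennreal (1 / \<rho>) * (ennreal \<rho> *
      (\<integral>\<^sup>+x. ennreal (?g (1 + \<rho> * x)) * indicator {1..A} (1 + \<rho> * x) \<partial>lborel))" by simp
    also have "\<dots> = (\<integral>\<^sup>+x. ennreal (?g (1 + \<rho> * x)) * indicator {1..A} (1 + \<rho> * x) \<partial>lborel)"
      using \<rho> by (simp flip: mult.assoc ennreal_mult)
    finally show ?thesis using \<rho> unfolding pair_prob_def by (simp flip: ennreal_mult')
  qed
  finally show ?thesis
    using pair_prob_nonneg[of \<rho> A s] \<rho> A unfolding A_def[symmetric] measure_def by simp
qed

end

section \<open>Independence of the decoding pattern from the collector links\<close>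

definition decode_prob :: "real \<Rightarrow> real \<Rightarrow> real" where
  "decode_prob Q \<rho> = exp (- ((2 powr Q - 1) / \<rho>))"

lemma threshold_nonneg: "\<rho> > 0 \<Longrightarrow> Q > 0 \<Longrightarrow> 0 \<le> (2 powr Q - 1) / \<rho>" for Q \<rho> :: real
  by (intro divide_nonneg_pos) (auto simp: ge_one_powr_ge_zero)

lemma decode_prob_pos: "0 < decode_prob Q \<rho>"
  by (simp add: decode_prob_def)

context iid_gains
begin

lemma prob_decodes:
  assumes "i \<in> {1..K}" "\<rho> > 0" "Q > 0"
  shows "prob {\<omega> \<in> space M. Q \<le> link_rate \<rho> (hs i \<omega>)} = decode_prob Q \<rho>"
  using prob_tail(1)[OF gaussian(1)[OF assms(1)] threshold_nonneg[OF assms(2,3)]] assms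
  by (simp add: link_rate_ge_iff decode_prob_def)

lemma prob_rate_exceeds:
  assumes "i \<in> {1..K}" "\<rho> > 0" "Q > 0"
  shows "prob {\<omega> \<in> space M. Q < link_rate \<rho> (hc i \<omega>)} = decode_prob Q \<rho>"
proof -
  have "Q < link_rate \<rho> (hc i \<omega>) \<longleftrightarrow> (2 powr Q - 1) / \<rho> < (cmod (hc i \<omega>))\<^sup>2" for \<omega>
  proof -
    have "0 < 1 + \<rho> * (cmod (hc i \<omega>))\<^sup>2" using assms by (simp add: add_pos_nonneg)
    thus ?thesis using assms unfolding link_rate_def by (subst less_log_iff) (auto simp: field_simps)
  qed
  thus ?thesis
    using prob_tail(2)[OF gaussian(2)[OF assms(1)] threshold_nonneg[OF assms(2,3)]] assms
    by (simp add: decode_prob_def)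
qed

text \<open>The gains from the source and those to the collector form two independent blocks. Nodes
  of \<open>U\<close> must decode and nodes of \<open>V\<close> must not, while all others are free;
  inside the source block this is a box, so its probability is a product.\<close>

lemma prob_decode_pattern:
  assumes U: "U \<subseteq> {1..K}" "U \<noteq> {}" and V: "V \<subseteq> {1..K}" "U \<inter> V = {}" and c: "c \<in> {1..K}" "i \<in> {1..K}"
    and \<rho>: "\<rho> > 0" and Q: "Q > 0" and \<Phi>: "{z. \<Phi> (fst z) (snd z)} \<in> sets (borel \<Otimes>\<^sub>M borel)"
  shows "prob {\<omega> \<in> space M. U \<subseteq> decoding_set K Q hs \<rho> \<omega> \<and> V \<inter> decoding_set K Q hs \<rho> \<omega> = {} \<and>
      \<Phi> (hc c \<omega>) (hc i \<omega>)} =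
    decode_prob Q \<rho> ^ card U * (1 - decode_prob Q \<rho>) ^ card V * prob {\<omega> \<in> space M. \<Phi> (hc c \<omega>) (hc i \<omega>)}"
proof -
  let ?X = "case_sum hs hc"
  let ?N = "{1..K}"
  have fin: "finite U" "finite V" using U V finite_subset by blast+
  define G where "G i = (if i \<in> U then {z. Q \<le> link_rate \<rho> z} else {z. link_rate \<rho> z < Q})" for i
  have G: "G i \<in> sets borel" for i unfolding G_def by simp
  have ind: "indep_var (PiM (Inl ` (U \<union> V)) (\<lambda>_. borel)) (\<lambda>\<omega>. restrict (\<lambda>j. ?X j \<omega>) (Inl ` (U \<union> V)))
     (PiM (Inr ` ?N) (\<lambda>_. borel)) (\<lambda>\<omega>. restrict (\<lambda>j. ?X j \<omega>) (Inr ` ?N))"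
    by (rule indep_var_restrict[OF indep]) (use U V in auto)
  \<comment> \<open>\<open>E1\<close> is the box for the source block and \<open>E2\<close> the
    cylinder over the two coordinates on which \<open>\<Phi>\<close> depends; the event is the
    preimage of their product.\<close>
  define E1 where "E1 = Pi\<^sub>E (Inl ` (U \<union> V) :: (nat + nat) set) (\<lambda>j. case_sum G (\<lambda>_. UNIV) j)"
  have E1: "E1 \<in> sets (PiM (Inl ` (U \<union> V) :: (nat + nat) set) (\<lambda>_. borel :: complex measure))"
    unfolding E1_def by (rule sets_PiM_I_finite) (use fin G in auto)
  define E2 where "E2 = (\<lambda>x. (x (Inr c), x (Inr i))) -` {z. \<Phi> (fst z) (snd z)} \<inter>
      space (PiM (Inr ` ?N :: (nat + nat) set) (\<lambda>_. borel :: complex measure))"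
  have E2: "E2 \<in> sets (PiM (Inr ` ?N :: (nat + nat) set) (\<lambda>_. borel :: complex measure))"
    unfolding E2_def by (rule measurable_sets[OF _ \<Phi>]) (use c in auto)
  have "{\<omega> \<in> space M. U \<subseteq> decoding_set K Q hs \<rho> \<omega> \<and> V \<inter> decoding_set K Q hs \<rho> \<omega> = {} \<and>
      \<Phi> (hc c \<omega>) (hc i \<omega>)} =
    (\<lambda>\<omega>. (restrict (\<lambda>j. ?X j \<omega>) (Inl ` (U \<union> V)), restrict (\<lambda>j. ?X j \<omega>) (Inr ` ?N))) -` (E1 \<times> E2) \<inter> space M"
  proof -
    have "(restrict (\<lambda>j. ?X j \<omega>) (Inl ` (U \<union> V)) \<in> E1) \<longleftrightarrow>
       U \<subseteq> decoding_set K Q hs \<rho> \<omega> \<and> V \<inter> decoding_set K Q hs \<rho> \<omega> = {}" for \<omega>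
    proof -
      have "restrict (\<lambda>j. ?X j \<omega>) (Inl ` (U \<union> V)) \<in> E1 \<longleftrightarrow> (\<forall>i\<in>U \<union> V. hs i \<omega> \<in> G i)"
        unfolding E1_def by (simp add: PiE_iff)
      also have "\<dots> \<longleftrightarrow> (\<forall>i\<in>U. Q \<le> link_rate \<rho> (hs i \<omega>)) \<and> (\<forall>i\<in>V. \<not> Q \<le> link_rate \<rho> (hs i \<omega>))"
        using V(2) unfolding G_def by (auto simp: not_le)
      also have "\<dots> \<longleftrightarrow> U \<subseteq> decoding_set K Q hs \<rho> \<omega> \<and> V \<inter> decoding_set K Q hs \<rho> \<omega> = {}"
        using U V unfolding decoding_set_def by blast
      finally show ?thesis .
    qed
    moreover have "restrict (\<lambda>j. ?X j \<omega>) (Inr ` ?N) \<in> E2 \<longleftrightarrow> \<Phi> (hc c \<omega>) (hc i \<omega>)" for \<omega>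
      using c unfolding E2_def by (auto simp: space_PiM)
    ultimately show ?thesis by auto
  qed
  also have "prob \<dots> = prob ((\<lambda>\<omega>. restrict (\<lambda>j. ?X j \<omega>) (Inl ` (U \<union> V))) -` E1 \<inter> space M) *
       prob ((\<lambda>\<omega>. restrict (\<lambda>j. ?X j \<omega>) (Inr ` ?N)) -` E2 \<inter> space M)"
    by (rule indep_varD[OF ind E1 E2])
  also have "(\<lambda>\<omega>. restrict (\<lambda>j. ?X j \<omega>) (Inr ` ?N)) -` E2 \<inter> space M = {\<omega> \<in> space M. \<Phi> (hc c \<omega>) (hc i \<omega>)}"
    using c unfolding E2_def by (auto simp: space_PiM)
  also have "(\<lambda>\<omega>. restrict (\<lambda>j. ?X j \<omega>) (Inl ` (U \<union> V))) -` E1 \<inter> space M =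
      (\<Inter>j\<in>Inl ` (U \<union> V). ?X j -` case_sum G (\<lambda>_. UNIV) j \<inter> space M)"
    using U unfolding E1_def by (auto simp: PiE_iff)
  also have "prob \<dots> = (\<Prod>j\<in>Inl ` (U \<union> V). prob (?X j -` case_sum G (\<lambda>_. UNIV) j \<inter> space M))"
    by (rule indep_varsD[OF indep]) (use U V fin G in auto)
  also have "\<dots> = (\<Prod>j\<in>U \<union> V. prob (hs j -` G j \<inter> space M))"
    by (subst prod.reindex) auto
  also have "\<dots> = (\<Prod>j\<in>U. prob (hs j -` G j \<inter> space M)) * (\<Prod>j\<in>V. prob (hs j -` G j \<inter> space M))"
    using fin V by (intro prod.union_disjoint) auto
  also have "(\<Prod>j\<in>U. prob (hs j -` G j \<inter> space M)) = (\<Prod>j\<in>U. decode_prob Q \<rho>)"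
  proof (rule prod.cong[OF refl])
    fix j assume "j \<in> U"
    hence "hs j -` G j \<inter> space M = {\<omega> \<in> space M. Q \<le> link_rate \<rho> (hs j \<omega>)}" by (auto simp: G_def)
    thus "prob (hs j -` G j \<inter> space M) = decode_prob Q \<rho>" using prob_decodes \<open>j \<in> U\<close> U \<rho> Q by auto
  qed
  also have "(\<Prod>j\<in>V. prob (hs j -` G j \<inter> space M)) = (\<Prod>j\<in>V. 1 - decode_prob Q \<rho>)"
  proof (rule prod.cong[OF refl])
    fix j assume "j \<in> V"
    hence j: "j \<in> {1..K}" "j \<notin> U" using V by auto
    have "hs j -` G j \<inter> space M = space M - {\<omega> \<in> space M. Q \<le> link_rate \<rho> (hs j \<omega>)}"
      using j by (auto simp: G_def)
    also have "prob \<dots> = 1 - decode_prob Q \<rho>"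
      using j \<rho> Q gain_measurable(1)[OF j(1)] by (subst prob_compl) (auto simp: prob_decodes)
    finally show "prob (hs j -` G j \<inter> space M) = 1 - decode_prob Q \<rho>" .
  qed
  finally show ?thesis by simp
qed

end

section \<open>Recovery as a condition on the decoding set and the rates\<close>

text \<open>A form of success without the supremum and without probability. The condition that the
  decoding nodes hold at least 1 is implicit, because feasible fractions add up to 1.\<close>

definition recoverable :: "nat set \<Rightarrow> (nat \<Rightarrow> real) \<Rightarrow> real \<Rightarrow> (nat \<Rightarrow> real) \<Rightarrow> bool" where
  "recoverable D a Q R \<longleftrightarrow> (\<exists>t\<in>feasible_fractions D a. Q < (\<Sum>i\<in>D. t i * R i))"

lemma finite_decoding_set [simp]: "finite (decoding_set K Q hs \<rho> \<omega>)"
  by (simp add: decoding_set_def)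

lemma decoding_set_subset: "decoding_set K Q hs \<rho> \<omega> \<subseteq> {1..K}"
  by (auto simp: decoding_set_def)

text \<open>The supremum of a nonempty set bounded above exceeds \<open>Q\<close> iff some element
  does. Nonemptiness is witnessed by scaling \<open>a\<close> down to total 1 on the decoding set;
  conversely a feasible vector forces the total of \<open>a\<close> to be at least 1.\<close>

lemma recovery_succeeds_iff:
  assumes \<rho>: "\<rho> > 0" and a: "\<And>i. i \<in> {1..K} \<Longrightarrow> a i \<ge> 0"
  shows "recovery_succeeds K Q hs hc a \<rho> \<omega> \<longleftrightarrow>
     recoverable (decoding_set K Q hs \<rho> \<omega>) a Q (\<lambda>i. link_rate \<rho> (hc i \<omega>))"
proof -
  define D where "D = decoding_set K Q hs \<rho> \<omega>"
  let ?R = "\<lambda>i. link_rate \<rho> (hc i \<omega>)"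
  let ?v = "\<lambda>t. \<Sum>i\<in>D. t i * ?R i"
  have D: "finite D" "D \<subseteq> {1..K}" unfolding D_def using decoding_set_subset by simp_all
  have bdd: "bdd_above (?v ` feasible_fractions D a)"
    by (rule bdd_aboveI2[of _ _ "\<Sum>i\<in>D. a i * ?R i"])
       (auto intro!: sum_mono mult_right_mono link_rate_nonneg \<rho> simp: feasible_fractions_def)
  have "(\<Sum>i\<in>D. a i) \<ge> 1 \<and> (SUP t\<in>feasible_fractions D a. ?v t) > Q \<longleftrightarrow> recoverable D a Q ?R"
  proof
    assume *: "(\<Sum>i\<in>D. a i) \<ge> 1 \<and> (SUP t\<in>feasible_fractions D a. ?v t) > Q"
    let ?t = "\<lambda>i. a i / (\<Sum>i\<in>D. a i)"
    have nonneg: "0 \<le> a i" if "i \<in> D" for i using that D a by auto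
    have "?t \<in> feasible_fractions D a"
      unfolding feasible_fractions_def
    proof (intro CollectI conjI ballI)
      fix i assume i: "i \<in> D"
      have "a i * 1 \<le> a i * (\<Sum>i\<in>D. a i)" using * nonneg[OF i] by (intro mult_left_mono) auto
      thus "a i / (\<Sum>i\<in>D. a i) \<le> a i" using * by (simp add: divide_le_eq)
      show "0 \<le> a i / (\<Sum>i\<in>D. a i)" using * nonneg[OF i] by simp
    next
      show "(\<Sum>i\<in>D. a i / (\<Sum>i\<in>D. a i)) = 1" using * by (simp flip: sum_divide_distrib)
    qed
    hence "feasible_fractions D a \<noteq> {}" by auto
    with * show "recoverable D a Q ?R"
      unfolding recoverable_def using less_cSUP_iff[OF _ bdd] by blast
  next
    assume "recoverable D a Q ?R"
    then obtain t where t: "t \<in> feasible_fractions D a" "Q < ?v t"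
      unfolding recoverable_def by blast
    have "1 = (\<Sum>i\<in>D. t i)" using t by (simp add: feasible_fractions_def)
    also have "\<dots> \<le> (\<Sum>i\<in>D. a i)" using t by (intro sum_mono) (auto simp: feasible_fractions_def)
    finally show "(\<Sum>i\<in>D. a i) \<ge> 1 \<and> (SUP t\<in>feasible_fractions D a. ?v t) > Q"
      using t less_cSUP_iff[OF _ bdd] by blast
  qed
  thus ?thesis unfolding recovery_succeeds_def Let_def max_recovery_rate_def D_def .
qed

text \<open>Split by the finitely many values \<open>D\<close> of the decoding set. For fixed
  \<open>D\<close> success is a union of open half-spaces of rate vectors; the union may be
  uncountable, but it is open. The measure \<open>N\<close> is left general so that the product
  space of gains is covered as well.\<close>

lemma recovery_succeeds_measurable:
  assumes \<rho>: "\<rho> > 0" and a: "\<And>i. i \<in> {1..K} \<Longrightarrow> a i \<ge> 0"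
    and meas: "\<And>i. i \<in> {1..K} \<Longrightarrow> hs i \<in> borel_measurable N"
      "\<And>i. i \<in> {1..K} \<Longrightarrow> hc i \<in> borel_measurable N"
  shows "{\<omega> \<in> space N. recovery_succeeds K Q hs hc a \<rho> \<omega>} \<in> sets N"
proof -
  define E where "E D = {\<omega> \<in> space N. \<forall>i\<in>{1..K}. i \<in> D \<longleftrightarrow> Q \<le> link_rate \<rho> (hs i \<omega>)}" for D
  have E: "E D \<in> sets N" for D
  proof -
    have "{\<omega> \<in> space N. i \<in> D \<longleftrightarrow> Q \<le> link_rate \<rho> (hs i \<omega>)} \<in> sets N" if "i \<in> {1..K}" for i
      using meas(1)[OF that] by measurable
    thus ?thesis unfolding E_def by (intro sets.sets_Collect_finite_All) auto
  qed
  define S where "S D = {x :: nat \<Rightarrow> real. recoverable D a Q x}" for D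
  have S: "S D \<in> sets borel" for D
  proof -
    have "S D = (\<Union>t\<in>feasible_fractions D a. {x. Q < (\<Sum>i\<in>D. t i * x i)})"
      unfolding S_def recoverable_def by auto
    moreover have "open {x :: nat \<Rightarrow> real. Q < (\<Sum>i\<in>D. t i * x i)}" for t
      by (intro open_Collect_less continuous_intros continuous_on_product_coordinates)
    ultimately have "open (S D)" by auto
    thus ?thesis by simp
  qed
  \<comment> \<open>Rates outside \<open>D\<close> are set to 0, since measurability is available
    only for the gains of nodes in \<open>{1..K}\<close>.\<close>
  define F where "F D \<omega> = (\<lambda>i. if i \<in> D then link_rate \<rho> (hc i \<omega>) else 0)" for D \<omega>
  have F: "F D \<in> borel_measurable N" if "D \<subseteq> {1..K}" for D
  proof (rule measurable_coordinatewise_then_product)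
    fix i
    show "(\<lambda>\<omega>. F D \<omega> i) \<in> borel_measurable N"
      using that meas(2)[of i] by (cases "i \<in> D") (auto simp: F_def)
  qed
  have "{\<omega> \<in> space N. recovery_succeeds K Q hs hc a \<rho> \<omega>} =
     (\<Union>D\<in>Pow {1..K}. E D \<inter> (F D -` S D \<inter> space N))"
  proof -
    have 1: "\<omega> \<in> E D \<longleftrightarrow> \<omega> \<in> space N \<and> decoding_set K Q hs \<rho> \<omega> = D" if "D \<in> Pow {1..K}" for \<omega> D
      using that unfolding E_def decoding_set_def by auto
    have 2: "\<omega> \<in> F D -` S D \<longleftrightarrow> recoverable D a Q (\<lambda>i. link_rate \<rho> (hc i \<omega>))" for \<omega> D
      unfolding F_def S_def recoverable_def by simp
    show ?thesis
    proof (intro set_eqI)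
      fix \<omega>
      have "\<omega> \<in> (\<Union>D\<in>Pow {1..K}. E D \<inter> (F D -` S D \<inter> space N)) \<longleftrightarrow>
        (\<exists>D\<in>Pow {1..K}. \<omega> \<in> E D \<and> \<omega> \<in> F D -` S D \<and> \<omega> \<in> space N)" by blast
      also have "\<dots> \<longleftrightarrow> (\<exists>D\<in>Pow {1..K}. decoding_set K Q hs \<rho> \<omega> = D \<and>
          recoverable D a Q (\<lambda>i. link_rate \<rho> (hc i \<omega>)) \<and> \<omega> \<in> space N)"
        using 1 2 by (intro bex_cong refl) metis
      also have "\<dots> \<longleftrightarrow> \<omega> \<in> space N \<and>
          recoverable (decoding_set K Q hs \<rho> \<omega>) a Q (\<lambda>i. link_rate \<rho> (hc i \<omega>))"
        using decoding_set_subset[of K Q hs \<rho> \<omega>] by blast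
      also have "\<dots> \<longleftrightarrow> \<omega> \<in> space N \<and> recovery_succeeds K Q hs hc a \<rho> \<omega>"
        using recovery_succeeds_iff[OF \<rho> a, where hs = hs and hc = hc and Q = Q and \<omega> = \<omega>] by simp
      finally show "\<omega> \<in> {\<omega> \<in> space N. recovery_succeeds K Q hs hc a \<rho> \<omega>} \<longleftrightarrow>
        \<omega> \<in> (\<Union>D\<in>Pow {1..K}. E D \<inter> (F D -` S D \<inter> space N))" by simp
    qed
  qed
  also have "\<dots> \<in> sets N"
    using E S F by (intro sets.finite_UN sets.Int measurable_sets) auto
  finally show ?thesis .
qed

section \<open>Behaviour under a change of gains, labels or sizes\<close>

lemma recovery_succeeds_cong:
  assumes "\<And>i. i \<in> {1..K} \<Longrightarrow> hs i \<omega> = hs' i \<omega>'" "\<And>i. i \<in> {1..K} \<Longrightarrow> hc i \<omega> = hc' i \<omega>'"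
  shows "recovery_succeeds K Q hs hc a \<rho> \<omega> = recovery_succeeds K Q hs' hc' a \<rho> \<omega>'"
proof -
  have "decoding_set K Q hs \<rho> \<omega> = decoding_set K Q hs' \<rho> \<omega>'"
    using assms by (auto simp: decoding_set_def)
  moreover have "(\<Sum>i\<in>decoding_set K Q hs' \<rho> \<omega>'. t i * link_rate \<rho> (hc i \<omega>)) =
      (\<Sum>i\<in>decoding_set K Q hs' \<rho> \<omega>'. t i * link_rate \<rho> (hc' i \<omega>'))" for t
    using assms decoding_set_subset[of K Q hs' \<rho> \<omega>'] by (intro sum.cong) auto
  ultimately show ?thesis unfolding recovery_succeeds_def max_recovery_rate_def by simp
qed

text \<open>\<open>\<pi>\<close> maps the relabelled decoding set bijectively onto the original one,
  and feasible fractions are transported along it in both directions with the same total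
  rate.\<close>

lemma recovery_succeeds_permute:
  assumes \<pi>: "bij_betw \<pi> {1..K} {1..K}" and \<rho>: "\<rho> > 0" and a: "\<And>i. i \<in> {1..K} \<Longrightarrow> a i \<ge> 0"
  shows "recovery_succeeds K Q (\<lambda>i. hs (\<pi> i)) (\<lambda>i. hc (\<pi> i)) (\<lambda>i. a (\<pi> i)) \<rho> \<omega> =
     recovery_succeeds K Q hs hc a \<rho> \<omega>"
proof -
  define D where "D = decoding_set K Q hs \<rho> \<omega>"
  define D' where "D' = decoding_set K Q (\<lambda>i. hs (\<pi> i)) \<rho> \<omega>"
  let ?R = "\<lambda>i. link_rate \<rho> (hc i \<omega>)"
  have inN: "\<pi> i \<in> {1..K}" if "i \<in> {1..K}" for i using that \<pi> bij_betwE by blast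
  have "\<pi> ` D' = D"
  proof
    show "\<pi> ` D' \<subseteq> D" using inN by (auto simp: D_def D'_def decoding_set_def)
    show "D \<subseteq> \<pi> ` D'"
    proof
      fix i assume i: "i \<in> D"
      hence "i \<in> \<pi> ` {1..K}" using \<pi> by (auto simp: bij_betw_def D_def decoding_set_def)
      thus "i \<in> \<pi> ` D'" using i by (auto simp: D_def D'_def decoding_set_def)
    qed
  qed
  moreover have "inj_on \<pi> D'"
    using \<pi> unfolding D'_def bij_betw_def by (auto intro: inj_on_subset[OF _ decoding_set_subset])
  ultimately have bij: "bij_betw \<pi> D' D" by (simp add: bij_betw_def)
  note reindex = sum.reindex_bij_betw[OF bij]
  have inv: "inv_into D' \<pi> (\<pi> j) = j" if "j \<in> D'" for j
    using that bij by (simp add: bij_betw_def)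
  have "recoverable D' (\<lambda>i. a (\<pi> i)) Q (\<lambda>i. ?R (\<pi> i)) \<longleftrightarrow> recoverable D a Q ?R"
  proof
    assume "recoverable D' (\<lambda>i. a (\<pi> i)) Q (\<lambda>i. ?R (\<pi> i))"
    then obtain t where t: "t \<in> feasible_fractions D' (\<lambda>i. a (\<pi> i))" "Q < (\<Sum>i\<in>D'. t i * ?R (\<pi> i))"
      unfolding recoverable_def by blast
    let ?t = "\<lambda>i. t (inv_into D' \<pi> i)"
    have "(\<Sum>i\<in>D. ?t i * g i) = (\<Sum>j\<in>D'. t j * g (\<pi> j))" for g
      unfolding reindex[symmetric] by (simp add: inv)
    from this[of ?R] this[of "\<lambda>_. 1"] have "(\<Sum>i\<in>D. ?t i) = 1" "Q < (\<Sum>i\<in>D. ?t i * ?R i)"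
      using t by (auto simp: feasible_fractions_def)
    moreover have "0 \<le> ?t i \<and> ?t i \<le> a i" if "i \<in> D" for i
    proof -
      obtain j where "j \<in> D'" "i = \<pi> j" using \<open>i \<in> D\<close> unfolding bij_betw_imp_surj_on[OF bij, symmetric] by (rule imageE) simp
      thus ?thesis using t by (auto simp: inv feasible_fractions_def)
    qed
    ultimately show "recoverable D a Q ?R"
      unfolding recoverable_def feasible_fractions_def by (intro bexI[of _ ?t]) auto
  next
    assume "recoverable D a Q ?R"
    then obtain t where t: "t \<in> feasible_fractions D a" "Q < (\<Sum>i\<in>D. t i * ?R i)"
      unfolding recoverable_def by blast
    have "(\<Sum>j\<in>D'. t (\<pi> j) * ?R (\<pi> j)) = (\<Sum>i\<in>D. t i * ?R i)" "(\<Sum>j\<in>D'. t (\<pi> j)) = (\<Sum>i\<in>D. t i)"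
      by (rule reindex)+
    thus "recoverable D' (\<lambda>i. a (\<pi> i)) Q (\<lambda>i. ?R (\<pi> i))"
      using t bij unfolding recoverable_def feasible_fractions_def
      by (intro bexI[of _ "\<lambda>j. t (\<pi> j)"]) (auto simp: bij_betw_def)
  qed
  thus ?thesis
    using recovery_succeeds_iff[OF \<rho> a, where hs = hs and hc = hc]
      recovery_succeeds_iff[OF \<rho> a[OF inN], where hs = "\<lambda>i. hs (\<pi> i)" and hc = "\<lambda>i. hc (\<pi> i)"]
    unfolding D_def D'_def by simp
qed

lemma recoverable_mono:
  assumes "recoverable D a Q R" "finite D" "\<And>i. i \<in> D \<Longrightarrow> min (a i) 1 \<le> b i"
  shows "recoverable D b Q R"
proof -
  obtain t where t: "t \<in> feasible_fractions D a" "Q < (\<Sum>i\<in>D. t i * R i)"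
    using assms unfolding recoverable_def by blast
  have "t i \<le> b i" if "i \<in> D" for i
  proof -
    have "t i \<le> (\<Sum>i\<in>D. t i)"
      using t assms that by (intro member_le_sum) (auto simp: feasible_fractions_def)
    hence "t i \<le> min (a i) 1" using t that by (auto simp: feasible_fractions_def)
    thus ?thesis using assms(3)[OF that] by linarith
  qed
  thus ?thesis using t unfolding recoverable_def feasible_fractions_def by auto
qed

section \<open>Sufficient and necessary conditions for recovery\<close>

lemma recoverable_pair:
  assumes "finite D" "c \<in> D" "j \<in> D" "c \<noteq> j" "1 - r \<le> a c" "0 \<le> r" "r \<le> 1" "r \<le> a j"
    "\<And>i. i \<in> D \<Longrightarrow> a i \<ge> 0" "Q < (1 - r) * R c + r * R j"
  shows "recoverable D a Q R"
proof -
  define t where "t i = (if i = c then 1 - r else if i = j then r else 0)" for i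
  have sum: "(\<Sum>i\<in>D. t i * g i) = (1 - r) * g c + r * g j" for g :: "nat \<Rightarrow> real"
  proof -
    have "(\<Sum>i\<in>D. t i * g i) = (\<Sum>i\<in>{c, j}. t i * g i)"
      by (rule sum.mono_neutral_right) (use assms(1-3) in \<open>auto simp: t_def\<close>)
    thus ?thesis using assms(4) by (simp add: t_def)
  qed
  have "(\<Sum>i\<in>D. t i) = 1" using sum[of "\<lambda>_. 1"] by simp
  moreover have "0 \<le> t i \<and> t i \<le> a i" if "i \<in> D" for i
    using assms(4-8) assms(9)[OF that] by (simp add: t_def)
  ultimately have "t \<in> feasible_fractions D a" by (simp add: feasible_fractions_def)
  moreover have "Q < (\<Sum>i\<in>D. t i * R i)" unfolding sum by fact
  ultimately show ?thesis unfolding recoverable_def by blast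
qed

lemma recoverable_complete:
  assumes "finite D" "c \<in> D" "a c \<ge> 1" "\<And>i. i \<in> D \<Longrightarrow> a i \<ge> 0" "Q < R c"
  shows "recoverable D a Q R"
proof -
  define t where "t i = (if i = c then 1 else 0 :: real)" for i
  have sum: "(\<Sum>i\<in>D. t i * g i) = g c" for g :: "nat \<Rightarrow> real"
  proof -
    have "(\<Sum>i\<in>D. t i * g i) = (\<Sum>i\<in>{c}. t i * g i)"
      by (rule sum.mono_neutral_right) (use assms(1,2) in \<open>auto simp: t_def\<close>)
    thus ?thesis by (simp add: t_def)
  qed
  have "(\<Sum>i\<in>D. t i) = 1" using sum[of "\<lambda>_. 1"] by simp
  moreover have "0 \<le> t i \<and> t i \<le> a i" if "i \<in> D" for i
    using assms(3) assms(4)[OF that] by (simp add: t_def)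
  ultimately have "t \<in> feasible_fractions D a" by (simp add: feasible_fractions_def)
  moreover have "Q < (\<Sum>i\<in>D. t i * R i)" unfolding sum by fact
  ultimately show ?thesis unfolding recoverable_def by blast
qed

lemma finite_has_largest_value:
  fixes f :: "'a \<Rightarrow> 'b :: linorder"
  assumes "finite S" "S \<noteq> {}"
  shows "\<exists>i\<in>S. \<forall>j\<in>S. f j \<le> f i"
proof -
  have "Max (f ` S) \<in> f ` S" using assms by (intro Max_in) auto
  then obtain i where "i \<in> S" "f i = Max (f ` S)" by auto
  thus ?thesis using assms by (intro bexI[of _ i]) auto
qed

lemma sum_fractions_le:
  fixes t R :: "nat \<Rightarrow> real"
  assumes "\<And>i. i \<in> S \<Longrightarrow> 0 \<le> t i" "\<And>i. i \<in> S \<Longrightarrow> R i \<le> x"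
  shows "(\<Sum>i\<in>S. t i * R i) \<le> (\<Sum>i\<in>S. t i) * x"
  unfolding sum_distrib_right by (intro sum_mono mult_left_mono) (use assms in auto)

text \<open>The achieved rate is a weighted average, so some decoding node has a rate above
  \<open>Q\<close>. If it is the only decoding node, its fraction is 1, which forces it to be
  complete.\<close>

lemma recoverable_imp_good_rate:
  assumes "recoverable D a Q R"
  shows "\<exists>i\<in>D. Q < R i \<and> (a i \<ge> 1 \<or> (\<exists>j\<in>D. j \<noteq> i))"
proof -
  obtain t where t: "\<And>i. i \<in> D \<Longrightarrow> 0 \<le> t i" "\<And>i. i \<in> D \<Longrightarrow> t i \<le> a i" "(\<Sum>i\<in>D. t i) = 1"
      "Q < (\<Sum>i\<in>D. t i * R i)"
    using assms unfolding recoverable_def feasible_fractions_def by blast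
  have "\<exists>i\<in>D. Q < R i"
  proof (rule ccontr)
    assume "\<not> (\<exists>i\<in>D. Q < R i)"
    hence "R i \<le> Q" if "i \<in> D" for i using that by force
    with t(1) have "(\<Sum>i\<in>D. t i * R i) \<le> (\<Sum>i\<in>D. t i) * Q" by (rule sum_fractions_le)
    thus False using t(3,4) by simp
  qed
  then obtain i where i: "i \<in> D" "Q < R i" by blast
  have "a i \<ge> 1" if "\<not> (\<exists>j\<in>D. j \<noteq> i)"
  proof -
    have "D = {i}" using i(1) that by blast
    hence "t i = 1" using t(3) by simp
    thus ?thesis using t(2)[OF i(1)] by simp
  qed
  with i show ?thesis by blast
qed

text \<open>Moving all weight in \<open>C\<close> to its best decoding node \<open>c\<close>, and
  all weight \<open>u\<close> in \<open>I\<close> to its best decoding node \<open>i\<close>, only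
  raises the rate. As \<open>R c \<le> Q\<close>, node \<open>i\<close> must be the better one, so
  its weight may be raised further: to \<open>a i\<close> if it is the only decoding node of
  \<open>I\<close>, and to \<open>r\<close> otherwise.\<close>

lemma recoverable_without_good_complete:
  assumes rec: "recoverable D a Q R" and fin: "finite D" "finite I"
    and D: "D \<subseteq> C \<union> I \<union> Z" "C \<inter> I = {}" and Z: "\<And>i. i \<in> Z \<Longrightarrow> a i = 0"
    and I: "(\<Sum>i\<in>I. a i) \<le> r" "r < 1" "\<And>i. i \<in> I \<Longrightarrow> a i \<ge> 0"
    and bad: "\<And>c. c \<in> C \<inter> D \<Longrightarrow> R c \<le> Q"
  shows "\<exists>c\<in>C \<inter> D. (\<exists>i\<in>I \<inter> D. Q < (1 - a i) * R c + a i * R i) \<or>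
     (\<exists>i\<in>I \<inter> D. \<exists>i'\<in>I \<inter> D. i \<noteq> i' \<and> Q < (1 - r) * R c + r * R i)"
proof -
  obtain t where t: "\<And>i. i \<in> D \<Longrightarrow> 0 \<le> t i" "\<And>i. i \<in> D \<Longrightarrow> t i \<le> a i" "(\<Sum>i\<in>D. t i) = 1"
      "Q < (\<Sum>i\<in>D. t i * R i)"
    using rec unfolding recoverable_def feasible_fractions_def by blast
  have split: "(\<Sum>i\<in>D. t i * g i) = (\<Sum>i\<in>C \<inter> D. t i * g i) + (\<Sum>i\<in>I \<inter> D. t i * g i)" for g
  proof -
    have "(\<Sum>i\<in>D. t i * g i) = (\<Sum>i\<in>(C \<inter> D) \<union> (I \<inter> D). t i * g i)"
    proof (rule sum.mono_neutral_right[OF fin(1)])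
      show "\<forall>i\<in>D - (C \<inter> D \<union> I \<inter> D). t i * g i = 0"
      proof
        fix i assume "i \<in> D - (C \<inter> D \<union> I \<inter> D)"
        hence "i \<in> D" "a i = 0" using D Z by auto
        thus "t i * g i = 0" using t(1)[of i] t(2)[of i] by simp
      qed
    qed auto
    also have "\<dots> = (\<Sum>i\<in>C \<inter> D. t i * g i) + (\<Sum>i\<in>I \<inter> D. t i * g i)"
      using fin D by (intro sum.union_disjoint) auto
    finally show ?thesis .
  qed
  define u where "u = (\<Sum>i\<in>I \<inter> D. t i)"
  have u_le: "u \<le> (\<Sum>i\<in>I \<inter> D. a i)" unfolding u_def by (intro sum_mono t) auto
  also have "\<dots> \<le> (\<Sum>i\<in>I. a i)" using fin I by (intro sum_mono2) auto
  finally have ur: "u \<le> r" using I by simp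
  have tC: "(\<Sum>i\<in>C \<inter> D. t i) = 1 - u" using split[of "\<lambda>_. 1"] t(3) by (simp add: u_def)
  \<comment> \<open>The weight \<open>u\<close> is at most \<open>r < 1\<close>, so some weight has
    to remain in \<open>C\<close>.\<close>
  hence "C \<inter> D \<noteq> {}" using ur I by auto
  then obtain c where c: "c \<in> C \<inter> D" "\<And>i. i \<in> C \<inter> D \<Longrightarrow> R i \<le> R c"
    using finite_has_largest_value[of "C \<inter> D" R] fin by blast
  have "(\<Sum>i\<in>C \<inter> D. t i * R i) \<le> (1 - u) * R c"
    unfolding tC[symmetric] by (rule sum_fractions_le) (use t c in auto)
  hence main: "Q < (1 - u) * R c + (\<Sum>i\<in>I \<inter> D. t i * R i)" using split[of R] t by linarith
  have Rc: "R c \<le> Q" using bad c by auto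
  have ne: "I \<inter> D \<noteq> {}"
  proof
    assume "I \<inter> D = {}"
    with main Rc show False unfolding u_def by simp
  qed
  obtain i where i: "i \<in> I \<inter> D" "\<And>j. j \<in> I \<inter> D \<Longrightarrow> R j \<le> R i"
    using finite_has_largest_value[OF _ ne, of R] fin by blast
  have "(\<Sum>i\<in>I \<inter> D. t i * R i) \<le> u * R i"
    unfolding u_def by (rule sum_fractions_le) (use t i in auto)
  hence iu: "Q < (1 - u) * R c + u * R i" using main by linarith
  have u0: "0 \<le> u" unfolding u_def by (intro sum_nonneg) (use t in auto)
  have "R c < R i"
  proof (rule ccontr)
    assume "\<not> R c < R i"
    hence "u * R i \<le> u * R c" using u0 by (intro mult_left_mono) auto
    thus False using iu Rc by (simp add: left_diff_distrib)
  qed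
  hence grow: "Q < (1 - v) * R c + v * R i" if "u \<le> v" for v
  proof -
    have "(v - u) * R c \<le> (v - u) * R i" using that \<open>R c < R i\<close> by (intro mult_left_mono) auto
    thus ?thesis using iu by (simp add: algebra_simps)
  qed
  show ?thesis
  proof (cases "I \<inter> D = {i}")
    case True
    hence "u \<le> a i" using u_le by simp
    with grow[of "a i"] c(1) i(1) show ?thesis by blast
  next
    case False
    then obtain i' where "i' \<in> I \<inter> D" "i \<noteq> i'" using i(1) by blast
    with grow[OF ur] c(1) i(1) show ?thesis by blast
  qed
qed

section \<open>Symmetry and bounds on the success probability\<close>

context iid_gains
begin

lemma iid_gains_permute:
  assumes \<pi>: "bij_betw \<pi> {1..K} {1..K}"
  shows "iid_gains M K (\<lambda>i. hs (\<pi> i)) (\<lambda>i. hc (\<pi> i))"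
proof -
  have inN: "\<pi> i \<in> {1..K}" if "i \<in> {1..K}" for i using that \<pi> bij_betwE by blast
  have "inj_on (map_sum \<pi> \<pi>) ({1..K} <+> {1..K})"
  proof (rule inj_onI)
    fix x y assume "x \<in> {1..K} <+> {1..K}" "y \<in> {1..K} <+> {1..K}" "map_sum \<pi> \<pi> x = map_sum \<pi> \<pi> y"
    thus "x = y" using inj_onD[OF bij_betw_imp_inj_on[OF \<pi>]] by (cases x; cases y) auto
  qed
  moreover have "map_sum \<pi> \<pi> ` ({1..K} <+> {1..K}) \<subseteq> {1..K} <+> {1..K}"
  proof
    fix y assume "y \<in> map_sum \<pi> \<pi> ` ({1..K} <+> {1..K})"
    then obtain x where "x \<in> {1..K} <+> {1..K}" "y = map_sum \<pi> \<pi> x" by blast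
    thus "y \<in> {1..K} <+> {1..K}" using inN by (cases x) auto
  qed
  ultimately have "indep_vars (\<lambda>_. borel) (\<lambda>j. case_sum hs hc (map_sum \<pi> \<pi> j)) ({1..K} <+> {1..K})"
    by (rule indep_vars_reindex[OF indep])
  also have "(\<lambda>j. case_sum hs hc (map_sum \<pi> \<pi> j)) = case_sum (\<lambda>i. hs (\<pi> i)) (\<lambda>i. hc (\<pi> i))"
  proof
    show "case_sum hs hc (map_sum \<pi> \<pi> j) = case_sum (\<lambda>i. hs (\<pi> i)) (\<lambda>i. hc (\<pi> i)) j" for j
      by (cases j) simp_all
  qed
  finally show ?thesis
    unfolding iid_gains_def iid_gains_axioms_def iid_gaussian_gains_def
    using gaussian(1)[OF inN] gaussian(2)[OF inN] prob_space_axioms by (intro conjI ballI)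
qed

text \<open>Joint independence together with the common marginal determines the joint law, the basis
  for treating the nodes as exchangeable.\<close>

lemma joint_law:
  assumes "K \<ge> 1"
  shows "distr M (PiM ({1..K} <+> {1..K}) (\<lambda>_. borel)) (\<lambda>\<omega>. \<lambda>j\<in>{1..K} <+> {1..K}. case_sum hs hc j \<omega>) =
    PiM ({1..K} <+> {1..K}) (\<lambda>_. density lborel (\<lambda>z. ennreal (exp (- (cmod z)\<^sup>2) / pi)))"
proof -
  let ?J = "{1..K} <+> {1..K}" and ?X = "case_sum hs hc"
  have law: "distr M borel (?X j) = density lborel (\<lambda>z. ennreal (exp (- (cmod z)\<^sup>2) / pi))" if "j \<in> ?J" for j
  proof -
    have "std_complex_gaussian M (?X j)" using that gaussian by auto
    hence "distr M lborel (?X j) = density lborel (\<lambda>z. ennreal (exp (- (cmod z)\<^sup>2) / pi))"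
      unfolding std_complex_gaussian_def distributed_def by auto
    moreover have "distr M borel (?X j) = distr M lborel (?X j)" by (rule distr_cong) auto
    ultimately show ?thesis by simp
  qed
  have "distr M (PiM ?J (\<lambda>_. borel)) (\<lambda>\<omega>. \<lambda>j\<in>?J. ?X j \<omega>) = PiM ?J (\<lambda>j. distr M borel (?X j))"
  proof (rule iffD1[OF indep_vars_iff_distr_eq_PiM' indep])
    show "?J \<noteq> {}" using assms by auto
    show "?X j \<in> borel_measurable M" if "j \<in> ?J" for j using that gain_measurable by auto
  qed
  also have "\<dots> = PiM ?J (\<lambda>_. density lborel (\<lambda>z. ennreal (exp (- (cmod z)\<^sup>2) / pi)))"
    by (rule PiM_cong) (use law in auto)
  finally show ?thesis .
qed

text \<open>The right-hand side does not involve the given gains. Any two families satisfying the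
  model therefore have the same failure probability, even on different probability spaces.\<close>

lemma failure_prob_joint_law:
  assumes "K \<ge> 1" and \<rho>: "\<rho> > 0" and a: "\<And>i. i \<in> {1..K} \<Longrightarrow> a i \<ge> 0"
  shows "failure_prob M K Q hs hc a \<rho> =
    measure (PiM ({1..K} <+> {1..K}) (\<lambda>_. density lborel (\<lambda>z. ennreal (exp (- (cmod z)\<^sup>2) / pi))))
      {x \<in> space (PiM ({1..K} <+> {1..K}) (\<lambda>_. borel)).
        \<not> recovery_succeeds K Q (\<lambda>i x. x (Inl i)) (\<lambda>i x. x (Inr i)) a \<rho> x}"
proof -
  let ?J = "{1..K} <+> {1..K}" and ?X = "case_sum hs hc"
  let ?P = "PiM ?J (\<lambda>_. borel :: complex measure)"
  let ?F = "\<lambda>\<omega>. \<lambda>j\<in>?J. ?X j \<omega>"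
  let ?B = "{x \<in> space ?P. \<not> recovery_succeeds K Q (\<lambda>i x. x (Inl i)) (\<lambda>i x. x (Inr i)) a \<rho> x}"
  have F: "?F \<in> measurable M ?P"
    by (rule measurable_restrict) (use gain_measurable in auto)
  have "{x \<in> space ?P. recovery_succeeds K Q (\<lambda>i x. x (Inl i)) (\<lambda>i x. x (Inr i)) a \<rho> x} \<in> sets ?P"
    by (rule recovery_succeeds_measurable[OF \<rho> a]) (auto intro!: measurable_component_singleton)
  hence B: "?B \<in> sets ?P" by (rule sets.sets_Collect_neg)
  have "recovery_succeeds K Q (\<lambda>i x. x (Inl i)) (\<lambda>i x. x (Inr i)) a \<rho> (?F \<omega>) =
      recovery_succeeds K Q hs hc a \<rho> \<omega>" for \<omega>
    by (rule recovery_succeeds_cong) auto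
  hence "\<omega> \<in> {\<omega> \<in> space M. \<not> recovery_succeeds K Q hs hc a \<rho> \<omega>} \<longleftrightarrow> \<omega> \<in> ?F -` ?B \<inter> space M" for \<omega>
    using measurable_space[OF F, of \<omega>] unfolding vimage_def Int_iff mem_Collect_eq by blast
  hence "{\<omega> \<in> space M. \<not> recovery_succeeds K Q hs hc a \<rho> \<omega>} = ?F -` ?B \<inter> space M"
    by (rule set_eqI)
  hence "failure_prob M K Q hs hc a \<rho> = prob (?F -` ?B \<inter> space M)"
    unfolding failure_prob_def by (rule arg_cong)
  also have "\<dots> = measure (distr M ?P ?F) ?B"
    by (rule measure_distr[OF F B, symmetric])
  finally show ?thesis unfolding joint_law[OF \<open>K \<ge> 1\<close>] .
qed

text \<open>Permuting the gains alone preserves their joint law; permuting gains and allocation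
  together preserves the outcome. Combining the two shows that permuting the allocation alone
  changes nothing.\<close>

lemma failure_prob_permute:
  assumes "K \<ge> 1" and \<rho>: "\<rho> > 0" and a: "\<And>i. i \<in> {1..K} \<Longrightarrow> a i \<ge> 0"
    and \<pi>: "bij_betw \<pi> {1..K} {1..K}"
  shows "failure_prob M K Q hs hc (\<lambda>i. a (\<pi> i)) \<rho> = failure_prob M K Q hs hc a \<rho>"
proof -
  interpret P: iid_gains M K "\<lambda>i. hs (\<pi> i)" "\<lambda>i. hc (\<pi> i)" by (rule iid_gains_permute[OF \<pi>])
  have a\<pi>: "0 \<le> a (\<pi> i)" if "i \<in> {1..K}" for i using that \<pi> a bij_betwE by blast
  have "failure_prob M K Q hs hc (\<lambda>i. a (\<pi> i)) \<rho> =
      failure_prob M K Q (\<lambda>i. hs (\<pi> i)) (\<lambda>i. hc (\<pi> i)) (\<lambda>i. a (\<pi> i)) \<rho>"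
    by (simp only: failure_prob_joint_law[OF assms(1) \<rho> a\<pi>] P.failure_prob_joint_law[OF assms(1) \<rho> a\<pi>])
  also have "\<dots> = failure_prob M K Q hs hc a \<rho>"
  proof -
    have "recovery_succeeds K Q (\<lambda>i. hs (\<pi> i)) (\<lambda>i. hc (\<pi> i)) (\<lambda>i. a (\<pi> i)) \<rho> \<omega> =
        recovery_succeeds K Q hs hc a \<rho> \<omega>" for \<omega>
      by (rule recovery_succeeds_permute[OF \<pi> \<rho>]) (rule a)
    thus ?thesis unfolding failure_prob_def by simp
  qed
  finally show ?thesis .
qed

lemma failure_prob_eq:
  assumes \<rho>: "\<rho> > 0" and a: "\<And>i. i \<in> {1..K} \<Longrightarrow> a i \<ge> 0"
  shows "failure_prob M K Q hs hc a \<rho> = 1 - prob {\<omega> \<in> space M. recovery_succeeds K Q hs hc a \<rho> \<omega>}"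
proof -
  have "{\<omega> \<in> space M. \<not> recovery_succeeds K Q hs hc a \<rho> \<omega>} =
      space M - {\<omega> \<in> space M. recovery_succeeds K Q hs hc a \<rho> \<omega>}" by auto
  thus ?thesis unfolding failure_prob_def
    using prob_compl[OF recovery_succeeds_measurable[OF \<rho> a gain_measurable]] by simp
qed

lemma decode_pattern_measurable:
  assumes "U \<subseteq> {1..K}" "V \<subseteq> {1..K}" and c: "c \<in> {1..K}" "i \<in> {1..K}"
    and \<Phi>: "{z. \<Phi> (fst z) (snd z)} \<in> sets (borel \<Otimes>\<^sub>M borel)"
  shows "{\<omega> \<in> space M. U \<subseteq> decoding_set K Q hs \<rho> \<omega> \<and> V \<inter> decoding_set K Q hs \<rho> \<omega> = {} \<and>
      \<Phi> (hc c \<omega>) (hc i \<omega>)} \<in> sets M"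
proof -
  have fin: "finite U" "finite V" using assms finite_subset by blast+
  have dec: "{\<omega> \<in> space M. Q \<le> link_rate \<rho> (hs i \<omega>)} \<in> sets M" if "i \<in> {1..K}" for i
    using gain_measurable(1)[OF that] by measurable
  have "(\<lambda>\<omega>. (hc c \<omega>, hc i \<omega>)) -` {z. \<Phi> (fst z) (snd z)} \<inter> space M \<in> sets M"
    using c by (intro measurable_sets[OF _ \<Phi>] measurable_Pair gain_measurable) auto
  also have "(\<lambda>\<omega>. (hc c \<omega>, hc i \<omega>)) -` {z. \<Phi> (fst z) (snd z)} \<inter> space M =
      {\<omega> \<in> space M. \<Phi> (hc c \<omega>) (hc i \<omega>)}" by auto
  finally have \<Phi>': "{\<omega> \<in> space M. \<Phi> (hc c \<omega>) (hc i \<omega>)} \<in> sets M" .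
  have "{\<omega> \<in> space M. \<forall>i\<in>U. Q \<le> link_rate \<rho> (hs i \<omega>)} \<in> sets M"
    by (rule sets.sets_Collect_finite_All[OF _ fin(1)]) (use assms(1) dec in blast)
  moreover have "{\<omega> \<in> space M. \<forall>i\<in>V. \<not> Q \<le> link_rate \<rho> (hs i \<omega>)} \<in> sets M"
    by (rule sets.sets_Collect_finite_All[OF _ fin(2)], rule sets.sets_Collect_neg) (use assms(2) dec in blast)
  ultimately have "{\<omega> \<in> space M. (\<forall>i\<in>U. Q \<le> link_rate \<rho> (hs i \<omega>)) \<and>
      (\<forall>i\<in>V. \<not> Q \<le> link_rate \<rho> (hs i \<omega>)) \<and> \<Phi> (hc c \<omega>) (hc i \<omega>)} \<in> sets M"
    using \<Phi>' by (intro sets.sets_Collect_conj)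
  moreover have "U \<subseteq> decoding_set K Q hs \<rho> \<omega> \<longleftrightarrow> (\<forall>i\<in>U. Q \<le> link_rate \<rho> (hs i \<omega>))"
    "V \<inter> decoding_set K Q hs \<rho> \<omega> = {} \<longleftrightarrow> (\<forall>i\<in>V. \<not> Q \<le> link_rate \<rho> (hs i \<omega>))" for \<omega>
    using assms(1,2) unfolding decoding_set_def by blast+
  ultimately show ?thesis by simp
qed

section \<open>Decoding patterns and the resulting bounds on success\<close>

abbreviation "pattern Q \<rho> U V \<omega> \<equiv>
  U \<subseteq> decoding_set K Q hs \<rho> \<omega> \<and> V \<inter> decoding_set K Q hs \<rho> \<omega> = {}"

abbreviation "pair_event Q \<rho> s c i \<omega> \<equiv>
  link_rate \<rho> (hc c \<omega>) \<le> Q \<and> Q < (1 - s) * link_rate \<rho> (hc c \<omega>) + s * link_rate \<rho> (hc i \<omega>)"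

lemma pattern_rate_measurable:
  assumes "U \<subseteq> {1..K}" "V \<subseteq> {1..K}" "c \<in> {1..K}"
  shows "{\<omega> \<in> space M. pattern Q \<rho> U V \<omega> \<and> Q < link_rate \<rho> (hc c \<omega>)} \<in> sets M"
proof -
  have "{z \<in> space (borel \<Otimes>\<^sub>M borel). Q < link_rate \<rho> (fst z)} \<in> sets (borel \<Otimes>\<^sub>M (borel :: complex measure))"
    by measurable
  hence "{z. Q < link_rate \<rho> (fst z)} \<in> sets (borel \<Otimes>\<^sub>M (borel :: complex measure))"
    by (simp add: space_pair_measure)
  from decode_pattern_measurable[OF assms(1-3) assms(3), of "\<lambda>x y. Q < link_rate \<rho> x", OF this]
  show ?thesis by (simp only: conj_assoc)
qed

lemma prob_pattern_rate:
  assumes "U \<subseteq> {1..K}" "U \<noteq> {}" "V \<subseteq> {1..K}" "U \<inter> V = {}" "c \<in> {1..K}" "\<rho> > 0" "Q > 0"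
  shows "prob {\<omega> \<in> space M. pattern Q \<rho> U V \<omega> \<and> Q < link_rate \<rho> (hc c \<omega>)} =
    decode_prob Q \<rho> ^ card U * (1 - decode_prob Q \<rho>) ^ card V * decode_prob Q \<rho>"
proof -
  have "{z \<in> space (borel \<Otimes>\<^sub>M borel). Q < link_rate \<rho> (fst z)} \<in> sets (borel \<Otimes>\<^sub>M (borel :: complex measure))"
    by measurable
  hence "{z. Q < link_rate \<rho> (fst z)} \<in> sets (borel \<Otimes>\<^sub>M (borel :: complex measure))"
    by (simp add: space_pair_measure)
  from prob_decode_pattern[OF assms(1-5) assms(5-7), of "\<lambda>x y. Q < link_rate \<rho> x", OF this]
  show ?thesis unfolding conj_assoc prob_rate_exceeds[OF assms(5-7)] .
qed

lemma pair_condition_measurable: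
  "{z. link_rate \<rho> (fst z) \<le> Q \<and> Q < (1 - s) * link_rate \<rho> (fst z) + s * link_rate \<rho> (snd z)}
     \<in> sets (borel \<Otimes>\<^sub>M borel)"
proof -
  have "{z \<in> space (borel \<Otimes>\<^sub>M borel). link_rate \<rho> (fst z) \<le> Q \<and>
      Q < (1 - s) * link_rate \<rho> (fst z) + s * link_rate \<rho> (snd z)} \<in> sets (borel \<Otimes>\<^sub>M borel)"
    by measurable
  thus ?thesis by (simp add: space_pair_measure)
qed

lemma pattern_pair_measurable:
  assumes "U \<subseteq> {1..K}" "V \<subseteq> {1..K}" "c \<in> {1..K}" "i \<in> {1..K}"
  shows "{\<omega> \<in> space M. pattern Q \<rho> U V \<omega> \<and> pair_event Q \<rho> s c i \<omega>} \<in> sets M"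
  using decode_pattern_measurable[OF assms, of "\<lambda>x y. link_rate \<rho> x \<le> Q \<and>
      Q < (1 - s) * link_rate \<rho> x + s * link_rate \<rho> y", OF pair_condition_measurable]
  by (simp only: conj_assoc)

lemma prob_pattern_pair:
  assumes "U \<subseteq> {1..K}" "U \<noteq> {}" "V \<subseteq> {1..K}" "U \<inter> V = {}" "c \<in> {1..K}" "i \<in> {1..K}" "\<rho> > 0" "Q > 0"
    and "c \<noteq> i" "0 < s" "s \<le> 1"
  shows "prob {\<omega> \<in> space M. pattern Q \<rho> U V \<omega> \<and> pair_event Q \<rho> s c i \<omega>} =
    decode_prob Q \<rho> ^ card U * (1 - decode_prob Q \<rho>) ^ card V * pair_prob (2 powr Q) s \<rho>"
  using prob_decode_pattern[OF assms(1-8), of "\<lambda>x y. link_rate \<rho> x \<le> Q \<and>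
      Q < (1 - s) * link_rate \<rho> x + s * link_rate \<rho> y", OF pair_condition_measurable]
  unfolding conj_assoc prob_pair[OF assms(5,6,9,7,8,10,11)] .

text \<open>Union bound over the alternatives of \<open>recoverable_imp_good_rate\<close>: a
  complete node that decodes and has a good link costs p^2, while two decoding nodes with a good
  link at the first cost p^3, for at most K^2 ordered pairs.\<close>

lemma success_upper_coarse:
  assumes \<rho>: "\<rho> > 0" and Q: "Q > 0" and a: "\<And>i. i \<in> {1..K} \<Longrightarrow> a i \<ge> 0"
  defines "p \<equiv> decode_prob Q \<rho>"
  shows "prob {\<omega> \<in> space M. recovery_succeeds K Q hs hc a \<rho> \<omega>} \<le>
    real (card {i \<in> {1..K}. a i \<ge> 1}) * p\<^sup>2 + (real K)\<^sup>2 * p ^ 3"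
proof -
  have succeeds_iff: "recovery_succeeds K Q hs hc a \<rho> \<omega> \<longleftrightarrow>
      recoverable (decoding_set K Q hs \<rho> \<omega>) a Q (\<lambda>i. link_rate \<rho> (hc i \<omega>))" for \<omega>
    by (rule recovery_succeeds_iff[OF \<rho>]) (rule a)
  let ?C = "{i \<in> {1..K}. a i \<ge> 1}"
  define E where "E U c = {\<omega> \<in> space M. pattern Q \<rho> U {} \<omega> \<and> Q < link_rate \<rho> (hc c \<omega>)}" for U c
  define J where "J = {(i, j). i \<in> {1..K} \<and> j \<in> {1..K} \<and> j \<noteq> i}"
  have J: "finite J" "card J \<le> K * K"
  proof -
    have "J \<subseteq> {1..K} \<times> {1..K}" by (auto simp: J_def)
    from finite_subset[OF this] card_mono[OF _ this] show "finite J" "card J \<le> K * K" by simp_all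
  qed
  have E: "E U c \<in> events" if "U \<subseteq> {1..K}" "c \<in> {1..K}" for U c
    unfolding E_def by (rule pattern_rate_measurable) (use that in auto)
  have E1: "E {c} c \<in> events" if "c \<in> ?C" for c using that by (intro E) auto
  have E2: "(case z of (i, j) \<Rightarrow> E {i, j} i) \<in> events" if "z \<in> J" for z
    using that by (auto simp: J_def intro!: E)
  have "{\<omega> \<in> space M. recovery_succeeds K Q hs hc a \<rho> \<omega>} \<subseteq>
     (\<Union>c\<in>?C. E {c} c) \<union> (\<Union>z\<in>J. case z of (i, j) \<Rightarrow> E {i, j} i)"
  proof
    fix \<omega> assume \<omega>: "\<omega> \<in> {\<omega> \<in> space M. recovery_succeeds K Q hs hc a \<rho> \<omega>}"
    let ?D = "decoding_set K Q hs \<rho> \<omega>"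
    have "recoverable ?D a Q (\<lambda>i. link_rate \<rho> (hc i \<omega>))"
      using \<omega> succeeds_iff by blast
    from recoverable_imp_good_rate[OF this] obtain i where
      i: "i \<in> ?D" "Q < link_rate \<rho> (hc i \<omega>)" "a i \<ge> 1 \<or> (\<exists>j\<in>?D. j \<noteq> i)" by blast
    have N: "?D \<subseteq> {1..K}" by (rule decoding_set_subset)
    from i(3) show "\<omega> \<in> (\<Union>c\<in>?C. E {c} c) \<union> (\<Union>z\<in>J. case z of (i, j) \<Rightarrow> E {i, j} i)"
    proof
      assume "a i \<ge> 1"
      hence "i \<in> ?C" "\<omega> \<in> E {i} i" using i N \<omega> by (auto simp: E_def)
      thus ?thesis by blast
    next
      assume "\<exists>j\<in>?D. j \<noteq> i"
      then obtain j where "j \<in> ?D" "j \<noteq> i" by blast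
      hence "(i, j) \<in> J" "\<omega> \<in> E {i, j} i" using i N \<omega> by (auto simp: E_def J_def)
      thus ?thesis by blast
    qed
  qed
  hence "prob {\<omega> \<in> space M. recovery_succeeds K Q hs hc a \<rho> \<omega>} \<le>
      prob ((\<Union>c\<in>?C. E {c} c) \<union> (\<Union>z\<in>J. case z of (i, j) \<Rightarrow> E {i, j} i))"
    using E1 E2 J by (intro finite_measure_mono sets.Un sets.finite_UN) auto
  also have "\<dots> \<le> prob (\<Union>c\<in>?C. E {c} c) + prob (\<Union>z\<in>J. case z of (i, j) \<Rightarrow> E {i, j} i)"
    using E1 E2 J by (intro measure_Un_le sets.finite_UN) auto
  also have "\<dots> \<le> (\<Sum>c\<in>?C. prob (E {c} c)) + (\<Sum>z\<in>J. prob (case z of (i, j) \<Rightarrow> E {i, j} i))"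
    using E1 E2 J by (intro add_mono finite_measure_subadditive_finite) auto
  also have "(\<Sum>c\<in>?C. prob (E {c} c)) = (\<Sum>c\<in>?C. p\<^sup>2)"
  proof (rule sum.cong[OF refl])
    fix c assume "c \<in> ?C"
    hence "c \<in> {1..K}" by simp
    thus "prob (E {c} c) = p\<^sup>2"
      unfolding E_def p_def using \<rho> Q by (subst prob_pattern_rate) (auto simp: power2_eq_square)
  qed
  also have "(\<Sum>z\<in>J. prob (case z of (i, j) \<Rightarrow> E {i, j} i)) = (\<Sum>z\<in>J. p ^ 3)"
  proof (rule sum.cong[OF refl])
    fix z assume "z \<in> J"
    then obtain i j where z: "z = (i, j)" "i \<in> {1..K}" "j \<in> {1..K}" "i \<noteq> j" by (auto simp: J_def)
    have "prob (E {i, j} i) = p ^ 3"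
      unfolding E_def p_def using \<rho> Q z(2-4)
      by (subst prob_pattern_rate) (auto simp: power2_eq_square power3_eq_cube)
    thus "prob (case z of (i, j) \<Rightarrow> E {i, j} i) = p ^ 3" using z by simp
  qed
  also have "(\<Sum>z\<in>J. p ^ 3) = real (card J) * p ^ 3" by simp
  also have "\<dots> \<le> real (K * K) * p ^ 3"
    using J decode_prob_pos[of Q \<rho>] unfolding p_def of_nat_le_iff
    by (intro mult_right_mono) (auto simp del: of_nat_mult)
  finally show ?thesis by (simp add: power2_eq_square)
qed

text \<open>Requiring that exactly one node of \<open>C\<close> decodes makes the events disjoint,
  so their probabilities add without correction; nodes outside \<open>C\<close> are left
  free.\<close>

lemma success_lower_coarse:
  assumes \<rho>: "\<rho> > 0" and Q: "Q > 0" and a: "\<And>i. i \<in> {1..K} \<Longrightarrow> a i \<ge> 0"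
    and C: "C \<subseteq> {1..K}" "\<And>c. c \<in> C \<Longrightarrow> a c \<ge> 1"
  defines "p \<equiv> decode_prob Q \<rho>"
  shows "real (card C) * (p\<^sup>2 * (1 - p) ^ (card C - 1)) \<le>
     prob {\<omega> \<in> space M. recovery_succeeds K Q hs hc a \<rho> \<omega>}"
proof -
  have succeeds_iff: "recovery_succeeds K Q hs hc a \<rho> \<omega> \<longleftrightarrow>
      recoverable (decoding_set K Q hs \<rho> \<omega>) a Q (\<lambda>i. link_rate \<rho> (hc i \<omega>))" for \<omega>
    by (rule recovery_succeeds_iff[OF \<rho>]) (rule a)
  define E where "E c = {\<omega> \<in> space M. pattern Q \<rho> {c} (C - {c}) \<omega> \<and> Q < link_rate \<rho> (hc c \<omega>)}" for c
  have fin: "finite C" using C finite_subset by blast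
  have E: "E c \<in> events" if "c \<in> C" for c
    unfolding E_def by (rule pattern_rate_measurable) (use that C in auto)
  have PE: "prob (E c) = p\<^sup>2 * (1 - p) ^ (card C - 1)" if "c \<in> C" for c
  proof -
    have "c \<in> {1..K}" using that C by auto
    moreover have "C - {c} \<subseteq> {1..K}" using C by auto
    ultimately show ?thesis
      unfolding E_def p_def using \<rho> Q that fin
      by (subst prob_pattern_rate) (auto simp: power2_eq_square)
  qed
  have "real (card C) * (p\<^sup>2 * (1 - p) ^ (card C - 1)) = (\<Sum>c\<in>C. prob (E c))"
    using PE by simp
  also have "\<dots> = prob (\<Union>c\<in>C. E c)"
    by (rule finite_measure_finite_Union[symmetric])
       (use fin E in \<open>auto simp: disjoint_family_on_def E_def\<close>)
  also have "\<dots> \<le> prob {\<omega> \<in> space M. recovery_succeeds K Q hs hc a \<rho> \<omega>}"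
  proof (rule finite_measure_mono)
    show "(\<Union>c\<in>C. E c) \<subseteq> {\<omega> \<in> space M. recovery_succeeds K Q hs hc a \<rho> \<omega>}"
    proof
      fix \<omega> assume "\<omega> \<in> (\<Union>c\<in>C. E c)"
      then obtain c where c: "c \<in> C" "\<omega> \<in> space M" "c \<in> decoding_set K Q hs \<rho> \<omega>"
        "Q < link_rate \<rho> (hc c \<omega>)" unfolding E_def by blast
      have "recoverable (decoding_set K Q hs \<rho> \<omega>) a Q (\<lambda>i. link_rate \<rho> (hc i \<omega>))"
      proof (rule recoverable_complete[where c = c])
        show "0 \<le> a i" if "i \<in> decoding_set K Q hs \<rho> \<omega>" for i
          using a that decoding_set_subset[of K Q hs \<rho> \<omega>] by blast
      qed (use c C(2) in auto)
      thus "\<omega> \<in> {\<omega> \<in> space M. recovery_succeeds K Q hs hc a \<rho> \<omega>}"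
        using c(2) succeeds_iff by blast
    qed
    show "{\<omega> \<in> space M. recovery_succeeds K Q hs hc a \<rho> \<omega>} \<in> events"
      by (rule recovery_succeeds_measurable[OF \<rho> a gain_measurable])
  qed
  finally show ?thesis .
qed

text \<open>This event depends on the allocation only through \<open>C\<close>. It occurs in both
  fine bounds and cancels in the comparison, so its exact probability is never computed.\<close>

definition good_complete :: "real \<Rightarrow> real \<Rightarrow> nat set \<Rightarrow> 'w set" where
  "good_complete Q \<rho> C = (\<Union>c\<in>C. {\<omega> \<in> space M. pattern Q \<rho> {c} {} \<omega> \<and> Q < link_rate \<rho> (hc c \<omega>)})"

lemma good_complete_events: "C \<subseteq> {1..K} \<Longrightarrow> good_complete Q \<rho> C \<in> events"
  unfolding good_complete_def
  by (intro sets.finite_UN pattern_rate_measurable) (auto intro: finite_subset)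

text \<open>Outside \<open>good_complete\<close>, \<open>recoverable_without_good_complete\<close>
  leaves two kinds of events for each complete node: one incomplete node of size \<open>a i\<close>
  also decodes, with factor p^2, or two incomplete nodes decode and the better one is credited with
  all of \<open>r\<close>, with factor p^3.\<close>

lemma success_upper_fine:
  assumes \<rho>: "\<rho> > 0" and Q: "Q > 0" and a: "\<And>i. i \<in> {1..K} \<Longrightarrow> a i \<ge> 0"
    and r: "0 < r" "r < 1"
  defines "p \<equiv> decode_prob Q \<rho>" and "C \<equiv> {i \<in> {1..K}. a i \<ge> 1}" and "I \<equiv> {i \<in> {1..K}. 0 < a i \<and> a i < 1}"
  assumes I: "(\<Sum>i\<in>I. a i) \<le> r"
  shows "prob {\<omega> \<in> space M. recovery_succeeds K Q hs hc a \<rho> \<omega>} \<le> prob (good_complete Q \<rho> C) +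
    real (card C) * (p\<^sup>2 * ((\<Sum>i\<in>I. pair_prob (2 powr Q) (a i) \<rho>) + (real K)\<^sup>2 * p * pair_prob (2 powr Q) r \<rho>))"
proof -
  have succeeds_iff: "recovery_succeeds K Q hs hc a \<rho> \<omega> \<longleftrightarrow>
      recoverable (decoding_set K Q hs \<rho> \<omega>) a Q (\<lambda>i. link_rate \<rho> (hc i \<omega>))" for \<omega>
    by (rule recovery_succeeds_iff[OF \<rho>]) (rule a)
  let ?H = "\<lambda>s. pair_prob (2 powr Q) s \<rho>"
  define J where "J = {(i, j). i \<in> I \<and> j \<in> I \<and> i \<noteq> j}"
  define E1 where "E1 c i = {\<omega> \<in> space M. pattern Q \<rho> {c, i} {} \<omega> \<and> pair_event Q \<rho> (a i) c i \<omega>}" for c i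
  define E2 where "E2 c z = {\<omega> \<in> space M. pattern Q \<rho> {c, fst z, snd z} {} \<omega> \<and> pair_event Q \<rho> r c (fst z) \<omega>}" for c z
  define E where "E c = (\<Union>i\<in>I. E1 c i) \<union> (\<Union>z\<in>J. E2 c z)" for c
  have CI: "C \<subseteq> {1..K}" "I \<subseteq> {1..K}" "C \<inter> I = {}" "finite C" "finite I"
    by (auto simp: C_def I_def)
  have J: "finite J" "card J \<le> K * K"
  proof -
    have "J \<subseteq> {1..K} \<times> {1..K}" using CI by (auto simp: J_def)
    from finite_subset[OF this] card_mono[OF _ this] show "finite J" "card J \<le> K * K" by simp_all
  qed
  have E1: "E1 c i \<in> events" if "c \<in> C" "i \<in> I" for c i
    unfolding E1_def by (rule pattern_pair_measurable) (use that CI in auto)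
  have E2: "E2 c z \<in> events" if "c \<in> C" "z \<in> J" for c z
    unfolding E2_def by (rule pattern_pair_measurable) (use that CI in \<open>auto simp: J_def\<close>)
  have E: "E c \<in> events" if "c \<in> C" for c
    unfolding E_def using E1 E2 that J CI by (intro sets.Un sets.finite_UN) auto
  have p0: "p > 0" unfolding p_def by (rule decode_prob_pos)
  have H0: "0 \<le> ?H s" for s using \<rho> by (intro pair_prob_nonneg) auto
  have PE: "prob (E c) \<le> p\<^sup>2 * ((\<Sum>i\<in>I. ?H (a i)) + (real K)\<^sup>2 * p * ?H r)" if c: "c \<in> C" for c
  proof -
    have "prob (E c) \<le> prob (\<Union>i\<in>I. E1 c i) + prob (\<Union>z\<in>J. E2 c z)"
      unfolding E_def using E1 E2 c J CI by (intro measure_Un_le sets.finite_UN) auto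
    also have "\<dots> \<le> (\<Sum>i\<in>I. prob (E1 c i)) + (\<Sum>z\<in>J. prob (E2 c z))"
      using E1 E2 c J CI by (intro add_mono finite_measure_subadditive_finite) auto
    also have "(\<Sum>i\<in>I. prob (E1 c i)) = (\<Sum>i\<in>I. p\<^sup>2 * ?H (a i))"
    proof (rule sum.cong[OF refl])
      fix i assume i: "i \<in> I"
      have "c \<noteq> i" "c \<in> {1..K}" "i \<in> {1..K}" "0 < a i" "a i \<le> 1" using i c by (auto simp: C_def I_def)
      thus "prob (E1 c i) = p\<^sup>2 * ?H (a i)"
        unfolding E1_def p_def using \<rho> Q by (subst prob_pattern_pair) (auto simp: power2_eq_square)
    qed
    also have "(\<Sum>z\<in>J. prob (E2 c z)) = (\<Sum>z\<in>J. p ^ 3 * ?H r)"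
    proof (rule sum.cong[OF refl])
      fix z assume z: "z \<in> J"
      have d: "c \<noteq> fst z" "c \<noteq> snd z" "fst z \<noteq> snd z" "c \<in> {1..K}" "fst z \<in> {1..K}" "snd z \<in> {1..K}"
        using z c CI by (auto simp: J_def)
      have card: "card {c, fst z, snd z} = 3" using d(1-3) by simp
      have "prob (E2 c z) = p ^ card {c, fst z, snd z} * (1 - p) ^ card ({} :: nat set) * ?H r"
        unfolding E2_def p_def
        by (rule prob_pattern_pair[OF _ _ _ _ d(4,5) \<rho> Q d(1)]) (use d(4-6) r in simp_all)
      thus "prob (E2 c z) = p ^ 3 * ?H r" unfolding card by simp
    qed
    also have "(\<Sum>z\<in>J. p ^ 3 * ?H r) = real (card J) * (p ^ 3 * ?H r)" by simp
    also have "\<dots> \<le> real (K * K) * (p ^ 3 * ?H r)"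
      using J p0 H0 unfolding of_nat_le_iff by (intro mult_right_mono) (auto simp del: of_nat_mult)
    finally have "prob (E c) \<le> (\<Sum>i\<in>I. p\<^sup>2 * ?H (a i)) + real (K * K) * (p ^ 3 * ?H r)" by simp
    also have "(\<Sum>i\<in>I. p\<^sup>2 * ?H (a i)) = p\<^sup>2 * (\<Sum>i\<in>I. ?H (a i))"
      by (rule sum_distrib_left[symmetric])
    also have "real (K * K) * (p ^ 3 * ?H r) = p\<^sup>2 * ((real K)\<^sup>2 * p * ?H r)"
      by (simp add: power2_eq_square power3_eq_cube)
    finally show ?thesis by (simp only: distrib_left)
  qed
  have "{\<omega> \<in> space M. recovery_succeeds K Q hs hc a \<rho> \<omega>} \<subseteq> good_complete Q \<rho> C \<union> (\<Union>c\<in>C. E c)"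
  proof
    fix \<omega> assume "\<omega> \<in> {\<omega> \<in> space M. recovery_succeeds K Q hs hc a \<rho> \<omega>}"
    hence \<omega>: "\<omega> \<in> space M" "recovery_succeeds K Q hs hc a \<rho> \<omega>" by auto
    let ?D = "decoding_set K Q hs \<rho> \<omega>" and ?R = "\<lambda>i. link_rate \<rho> (hc i \<omega>)"
    have N: "?D \<subseteq> {1..K}" by (rule decoding_set_subset)
    have rec: "recoverable ?D a Q ?R" using \<omega> succeeds_iff by blast
    show "\<omega> \<in> good_complete Q \<rho> C \<union> (\<Union>c\<in>C. E c)"
    proof (cases "\<exists>c\<in>C \<inter> ?D. Q < ?R c")
      case True
      then obtain c where c: "c \<in> C" "c \<in> ?D" "Q < ?R c" by blast
      hence "\<omega> \<in> {\<omega> \<in> space M. pattern Q \<rho> {c} {} \<omega> \<and> Q < link_rate \<rho> (hc c \<omega>)}"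
        using \<omega>(1) by simp
      thus ?thesis using c(1) unfolding good_complete_def by (intro UnI1 UN_I)
    next
      case False
      have "\<exists>c\<in>C \<inter> ?D. (\<exists>i\<in>I \<inter> ?D. Q < (1 - a i) * ?R c + a i * ?R i) \<or>
         (\<exists>i\<in>I \<inter> ?D. \<exists>i'\<in>I \<inter> ?D. i \<noteq> i' \<and> Q < (1 - r) * ?R c + r * ?R i)"
      proof (rule recoverable_without_good_complete[where D = ?D and a = a and Q = Q and R = ?R
            and I = I and C = C and Z = "{i \<in> {1..K}. a i = 0}" and r = r])
        show "?D \<subseteq> C \<union> I \<union> {i \<in> {1..K}. a i = 0}"
        proof
          fix i assume "i \<in> ?D"
          hence "i \<in> {1..K}" using N by blast
          thus "i \<in> C \<union> I \<union> {i \<in> {1..K}. a i = 0}"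
            using a[of i] not_less[of "a i" 1] by (cases "a i = 0") (auto simp: C_def I_def)
        qed
        show "?R c \<le> Q" if "c \<in> C \<inter> ?D" for c
        proof (rule leI)
          show "\<not> Q < ?R c" using False that by blast
        qed
        show "0 \<le> a i" if "i \<in> I" for i using that by (simp add: I_def)
      qed (use rec CI I r in simp_all)
      then obtain c where c: "c \<in> C" "c \<in> ?D" and
        alt: "(\<exists>i\<in>I \<inter> ?D. Q < (1 - a i) * ?R c + a i * ?R i) \<or>
         (\<exists>i\<in>I \<inter> ?D. \<exists>i'\<in>I \<inter> ?D. i \<noteq> i' \<and> Q < (1 - r) * ?R c + r * ?R i)" by blast
      have Rc: "?R c \<le> Q" using False c by (meson IntI not_less)
      from alt have "\<omega> \<in> E c"
      proof
        assume "\<exists>i\<in>I \<inter> ?D. Q < (1 - a i) * ?R c + a i * ?R i"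
        then obtain i where "i \<in> I" "i \<in> ?D" "Q < (1 - a i) * ?R c + a i * ?R i" by blast
        hence "\<omega> \<in> E1 c i" using c Rc \<omega>(1) unfolding E1_def by simp
        thus ?thesis using \<open>i \<in> I\<close> unfolding E_def by blast
      next
        assume "\<exists>i\<in>I \<inter> ?D. \<exists>i'\<in>I \<inter> ?D. i \<noteq> i' \<and> Q < (1 - r) * ?R c + r * ?R i"
        then obtain i i' where *: "i \<in> I" "i' \<in> I" "i \<noteq> i'" "i \<in> ?D" "i' \<in> ?D"
          "Q < (1 - r) * ?R c + r * ?R i" by blast
        hence "\<omega> \<in> E2 c (i, i')" using c Rc \<omega>(1) unfolding E2_def by simp
        moreover have "(i, i') \<in> J" using * by (simp add: J_def)
        ultimately show ?thesis unfolding E_def by blast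
      qed
      thus ?thesis using c by blast
    qed
  qed
  hence "prob {\<omega> \<in> space M. recovery_succeeds K Q hs hc a \<rho> \<omega>} \<le> prob (good_complete Q \<rho> C \<union> (\<Union>c\<in>C. E c))"
    using E CI good_complete_events by (intro finite_measure_mono sets.Un sets.finite_UN) auto
  also have "\<dots> \<le> prob (good_complete Q \<rho> C) + prob (\<Union>c\<in>C. E c)"
    using E CI good_complete_events by (intro measure_Un_le sets.finite_UN) auto
  also have "prob (\<Union>c\<in>C. E c) \<le> (\<Sum>c\<in>C. prob (E c))"
    using E CI by (intro finite_measure_subadditive_finite) auto
  also have "\<dots> \<le> (\<Sum>c\<in>C. p\<^sup>2 * ((\<Sum>i\<in>I. ?H (a i)) + (real K)\<^sup>2 * p * ?H r))"
    by (intro sum_mono PE)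
  finally show ?thesis by simp
qed

text \<open>Besides \<open>good_complete\<close>, count the events where \<open>c\<close> is the
  only decoding node of \<open>C\<close> and reaches the rate together with \<open>j\<close>. They
  are disjoint for different \<open>c\<close>, and disjoint from \<open>good_complete\<close>
  because the only decoding node of \<open>C\<close> has rate at most \<open>Q\<close>.\<close>

lemma success_lower_fine:
  assumes \<rho>: "\<rho> > 0" and Q: "Q > 0" and a: "\<And>i. i \<in> {1..K} \<Longrightarrow> a i \<ge> 0"
    and C: "C \<subseteq> {1..K}" "\<And>c. c \<in> C \<Longrightarrow> a c \<ge> 1"
    and j: "j \<in> {1..K}" "j \<notin> C" "a j = r" "0 < r" "r < 1"
  defines "p \<equiv> decode_prob Q \<rho>"
  shows "prob (good_complete Q \<rho> C) +
     real (card C) * (p\<^sup>2 * ((1 - p) ^ (card C - 1) * pair_prob (2 powr Q) r \<rho>)) \<le>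
     prob {\<omega> \<in> space M. recovery_succeeds K Q hs hc a \<rho> \<omega>}"
proof -
  have succeeds_iff: "recovery_succeeds K Q hs hc a \<rho> \<omega> \<longleftrightarrow>
      recoverable (decoding_set K Q hs \<rho> \<omega>) a Q (\<lambda>i. link_rate \<rho> (hc i \<omega>))" for \<omega>
    by (rule recovery_succeeds_iff[OF \<rho>]) (rule a)
  define E where "E c = {\<omega> \<in> space M. pattern Q \<rho> {c, j} (C - {c}) \<omega> \<and> pair_event Q \<rho> r c j \<omega>}" for c
  have fin: "finite C" using C finite_subset by blast
  have E: "E c \<in> events" if "c \<in> C" for c
    unfolding E_def by (rule pattern_pair_measurable) (use that C j in auto)
  have PE: "prob (E c) = p\<^sup>2 * ((1 - p) ^ (card C - 1) * pair_prob (2 powr Q) r \<rho>)" if "c \<in> C" for c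
  proof -
    have "c \<in> {1..K}" "c \<noteq> j" using that C j by auto
    moreover have "C - {c} \<subseteq> {1..K}" using C by auto
    moreover have "card {c, j} = 2" using \<open>c \<noteq> j\<close> by simp
    ultimately show ?thesis
      unfolding E_def p_def using \<rho> Q that fin j
      by (subst prob_pattern_pair) (auto simp: power2_eq_square)
  qed
  have disj: "good_complete Q \<rho> C \<inter> (\<Union>c\<in>C. E c) = {}"
  proof -
    have False if good: "\<omega> \<in> good_complete Q \<rho> C" and pair: "\<omega> \<in> E c" for \<omega> c
    proof -
      obtain d where d: "d \<in> C" "d \<in> decoding_set K Q hs \<rho> \<omega>" "Q < link_rate \<rho> (hc d \<omega>)"
        using good unfolding good_complete_def by blast
      have "(C - {c}) \<inter> decoding_set K Q hs \<rho> \<omega> = {}" "link_rate \<rho> (hc c \<omega>) \<le> Q"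
        using pair unfolding E_def by blast+
      with d show False by (cases "d = c") auto
    qed
    thus ?thesis by blast
  qed
  have "real (card C) * (p\<^sup>2 * ((1 - p) ^ (card C - 1) * pair_prob (2 powr Q) r \<rho>)) = (\<Sum>c\<in>C. prob (E c))"
    using PE by simp
  also have "\<dots> = prob (\<Union>c\<in>C. E c)"
  proof (rule finite_measure_finite_Union[symmetric, OF fin])
    show "disjoint_family_on E C"
      unfolding disjoint_family_on_def E_def by blast
  qed (use E in auto)
  also have "prob (good_complete Q \<rho> C) + \<dots> = prob (good_complete Q \<rho> C \<union> (\<Union>c\<in>C. E c))"
    by (rule finite_measure_Union[symmetric, OF _ _ disj])
       (use good_complete_events[OF C(1)] E fin in \<open>auto intro!: sets.finite_UN\<close>)
  also have "\<dots> \<le> prob {\<omega> \<in> space M. recovery_succeeds K Q hs hc a \<rho> \<omega>}"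
  proof (rule finite_measure_mono)
    show "good_complete Q \<rho> C \<union> (\<Union>c\<in>C. E c) \<subseteq> {\<omega> \<in> space M. recovery_succeeds K Q hs hc a \<rho> \<omega>}"
    proof
      fix \<omega> assume "\<omega> \<in> good_complete Q \<rho> C \<union> (\<Union>c\<in>C. E c)"
      let ?D = "decoding_set K Q hs \<rho> \<omega>" and ?R = "\<lambda>i. link_rate \<rho> (hc i \<omega>)"
      have aD: "a i \<ge> 0" if "i \<in> ?D" for i using a that decoding_set_subset[of K Q hs \<rho> \<omega>] by blast
      from \<open>\<omega> \<in> _\<close> have "\<omega> \<in> space M \<and> recoverable ?D a Q ?R"
      proof
        assume "\<omega> \<in> good_complete Q \<rho> C"
        then obtain c where c: "c \<in> C" "\<omega> \<in> space M" "c \<in> ?D" "Q < ?R c"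
          unfolding good_complete_def by blast
        have "recoverable ?D a Q ?R"
          by (rule recoverable_complete[where c = c]) (use c C(2) aD in auto)
        thus ?thesis using c(2) by blast
      next
        assume "\<omega> \<in> (\<Union>c\<in>C. E c)"
        then obtain c where c: "c \<in> C" "\<omega> \<in> space M" "c \<in> ?D" "j \<in> ?D" "Q < (1 - r) * ?R c + r * ?R j"
          unfolding E_def by blast
        have "recoverable ?D a Q ?R"
        proof (rule recoverable_pair[where c = c and j = j and r = r, OF finite_decoding_set c(3,4)])
          show "c \<noteq> j" using c j by blast
          show "1 - r \<le> a c" using C(2)[OF c(1)] j by linarith
        qed (use j aD c in auto)
        thus ?thesis using c by blast
      qed
      thus "\<omega> \<in> {\<omega> \<in> space M. recovery_succeeds K Q hs hc a \<rho> \<omega>}"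
        using succeeds_iff by blast
    qed
    show "{\<omega> \<in> space M. recovery_succeeds K Q hs hc a \<rho> \<omega>} \<in> events"
      by (rule recovery_succeeds_measurable[OF \<rho> a gain_measurable])
  qed
  finally show ?thesis by linarith
qed

end

section \<open>Comparison of allocations\<close>

text \<open>The complements of \<open>A\<close> and \<open>B\<close> have the same size, so any
  bijection between them completes \<open>f\<close>.\<close>

lemma bij_betw_extend:
  assumes "finite N" "A \<subseteq> N" "B \<subseteq> N" "bij_betw f A B"
  obtains \<pi> where "bij_betw \<pi> N N" "\<And>x. x \<in> A \<Longrightarrow> \<pi> x = f x"
proof -
  have "finite A" "finite B" using assms finite_subset by blast+
  hence "card (N - A) = card (N - B)"
    using assms bij_betw_same_card[OF assms(4)] by (simp add: card_Diff_subset)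
  then obtain g where g: "bij_betw g (N - A) (N - B)"
    using finite_same_card_bij[of "N - A" "N - B"] assms by auto
  define \<pi> where "\<pi> x = (if x \<in> A then f x else g x)" for x
  have "bij_betw \<pi> A B"
    by (rule iffD2[OF bij_betw_cong[of A \<pi> f] assms(4)]) (simp add: \<pi>_def)
  moreover have "bij_betw \<pi> (N - A) (N - B)"
    by (rule iffD2[OF bij_betw_cong[of "N - A" \<pi> g] g]) (simp add: \<pi>_def)
  ultimately have "bij_betw \<pi> (A \<union> (N - A)) (B \<union> (N - B))"
    by (rule bij_betw_combine) auto
  moreover have "A \<union> (N - A) = N" "B \<union> (N - B) = N" using assms by auto
  ultimately show ?thesis using that[of \<pi>] by (simp add: \<pi>_def)
qed

lemma tendsto_decode_prob:
  assumes "Q > 0"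
  shows "(decode_prob Q \<longlongrightarrow> 0) (at_right 0)"
proof -
  have "0 < 2 powr Q - (1 :: real)" using assms by simp
  from tendsto_exp_neg_div[OF this] show ?thesis
    unfolding decode_prob_def[abs_def] minus_divide_left .
qed

text \<open>The factor \<open>a i / r\<close> in the ratio bound is what makes the estimate
  additive: these factors sum to at most 1, leaving only the largest of the finitely many constants
  below 1.\<close>

lemma pair_prob_sum_ratio:
  assumes A: "A > 1" and r: "r < 1" and I: "finite I" "\<And>i. i \<in> I \<Longrightarrow> 0 < a i" "\<And>i. i \<in> I \<Longrightarrow> a i < r"
    and sum: "(\<Sum>i\<in>I. a i) \<le> r" and r0: "0 < r"
  shows "\<exists>\<theta><1. \<forall>\<^sub>F \<rho> in at_right 0. (\<Sum>i\<in>I. pair_prob A (a i) \<rho>) \<le> \<theta> * pair_prob A r \<rho>"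
proof -
  have "\<exists>\<theta>. \<forall>i\<in>I. \<theta> i < 1 \<and>
      (\<forall>\<^sub>F \<rho> in at_right 0. pair_prob A (a i) \<rho> \<le> \<theta> i * (a i / r) * pair_prob A r \<rho>)"
    by (intro bchoice ballI) (use pair_prob_ratio[OF A I(2) I(3) r] in auto)
  then obtain \<theta> where \<theta>: "\<And>i. i \<in> I \<Longrightarrow> \<theta> i < 1"
    "\<And>i. i \<in> I \<Longrightarrow> \<forall>\<^sub>F \<rho> in at_right 0. pair_prob A (a i) \<rho> \<le> \<theta> i * (a i / r) * pair_prob A r \<rho>"
    by blast
  \<comment> \<open>Including 0 covers empty \<open>I\<close> and makes \<open>\<theta>'\<close>
    nonnegative, as needed when the sum of sizes is bounded by \<open>r\<close>.\<close>
  define \<theta>' where "\<theta>' = Max (insert 0 (\<theta> ` I))"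
  have \<theta>': "0 \<le> \<theta>'" "\<theta>' < 1" "\<And>i. i \<in> I \<Longrightarrow> \<theta> i \<le> \<theta>'"
    using I(1) \<theta>(1) by (auto simp: \<theta>'_def)
  have "\<forall>\<^sub>F \<rho> in at_right 0. \<forall>i\<in>I. pair_prob A (a i) \<rho> \<le> \<theta> i * (a i / r) * pair_prob A r \<rho>"
    by (rule eventually_ball_finite[OF I(1)]) (use \<theta>(2) in blast)
  moreover have "\<forall>\<^sub>F \<rho> in at_right (0::real). \<rho> > 0"
    by (simp add: eventually_at_right_less)
  ultimately have "\<forall>\<^sub>F \<rho> in at_right 0. (\<Sum>i\<in>I. pair_prob A (a i) \<rho>) \<le> \<theta>' * pair_prob A r \<rho>"
  proof eventually_elim
    case (elim \<rho>)
    have H: "0 \<le> pair_prob A r \<rho>" using pair_prob_nonneg elim A by simp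
    have "(\<Sum>i\<in>I. pair_prob A (a i) \<rho>) \<le> (\<Sum>i\<in>I. \<theta>' * (a i / r) * pair_prob A r \<rho>)"
    proof (rule sum_mono)
      fix i assume i: "i \<in> I"
      have "0 \<le> a i / r" using I(2)[OF i] r0 by simp
      hence "\<theta> i * (a i / r) * pair_prob A r \<rho> \<le> \<theta>' * (a i / r) * pair_prob A r \<rho>"
        using \<theta>'(3)[OF i] H by (intro mult_right_mono)
      thus "pair_prob A (a i) \<rho> \<le> \<theta>' * (a i / r) * pair_prob A r \<rho>" using elim(1) i by force
    qed
    also have "\<dots> = \<theta>' * (((\<Sum>i\<in>I. a i) / r) * pair_prob A r \<rho>)"
      by (simp add: sum_distrib_left sum_distrib_right sum_divide_distrib mult_ac)
    also have "\<dots> \<le> \<theta>' * (1 * pair_prob A r \<rho>)"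
      using sum r0 H \<theta>'(1) by (intro mult_left_mono mult_right_mono) auto
    finally show ?case by simp
  qed
  with \<theta>' show ?thesis by blast
qed

section \<open>Eventual comparison of failure probabilities\<close>

context iid_gains
begin

text \<open>After division by p^2 the coarse bounds tend to the numbers of complete nodes, and these
  differ by at least 1.\<close>

lemma eventually_better_fewer_complete:
  assumes Q: "Q > 0" and a: "\<And>i. i \<in> {1..K} \<Longrightarrow> a i \<ge> 0" and b: "\<And>i. i \<in> {1..K} \<Longrightarrow> b i \<ge> 0"
    and C: "C \<subseteq> {1..K}" "\<And>c. c \<in> C \<Longrightarrow> b c \<ge> 1"
    and less: "card {i \<in> {1..K}. a i \<ge> 1} < card C"
  shows "\<forall>\<^sub>F \<rho> in at_right 0. failure_prob M K Q hs hc b \<rho> \<le> failure_prob M K Q hs hc a \<rho>"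
proof -
  let ?n = "card C" and ?p = "decode_prob Q" and ?m = "card {i \<in> {1..K}. a i \<ge> 1}"
  have "((\<lambda>\<rho>. real ?n * (1 - ?p \<rho>) ^ (?n - 1) - (real K)\<^sup>2 * ?p \<rho>) \<longlongrightarrow>
      real ?n * (1 - 0) ^ (?n - 1) - (real K)\<^sup>2 * 0) (at_right 0)"
    by (intro tendsto_intros tendsto_decode_prob Q)
  hence "\<forall>\<^sub>F \<rho> in at_right 0. real ?m < real ?n * (1 - ?p \<rho>) ^ (?n - 1) - (real K)\<^sup>2 * ?p \<rho>"
    by (rule order_tendstoD) (use less in simp)
  moreover have "\<forall>\<^sub>F \<rho> in at_right (0::real). \<rho> > 0"
    by (simp add: eventually_at_right_less)
  ultimately show ?thesis
  proof eventually_elim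
    case (elim \<rho>)
    let ?s = "\<lambda>a. prob {\<omega> \<in> space M. recovery_succeeds K Q hs hc a \<rho> \<omega>}"
    have "?s a \<le> real ?m * (?p \<rho>)\<^sup>2 + (real K)\<^sup>2 * ?p \<rho> ^ 3"
      by (rule success_upper_coarse[OF elim(2) Q]) (rule a)
    also have "\<dots> = (?p \<rho>)\<^sup>2 * (real ?m + (real K)\<^sup>2 * ?p \<rho>)"
      by (simp add: algebra_simps power2_eq_square power3_eq_cube)
    also have "\<dots> \<le> (?p \<rho>)\<^sup>2 * (real ?n * (1 - ?p \<rho>) ^ (?n - 1))"
      using elim by (intro mult_left_mono) auto
    also have "\<dots> = real ?n * ((?p \<rho>)\<^sup>2 * (1 - ?p \<rho>) ^ (?n - 1))" by simp
    also have "\<dots> \<le> ?s b"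
      by (rule success_lower_coarse[OF elim(2) Q]) (use b C in auto)
    finally have "?s a \<le> ?s b" .
    moreover have "failure_prob M K Q hs hc a \<rho> = 1 - ?s a" "failure_prob M K Q hs hc b \<rho> = 1 - ?s b"
      by (rule failure_prob_eq[OF elim(2)]; fact a b)+
    ultimately show ?case by linarith
  qed
qed

text \<open>With the same complete nodes, \<open>good_complete\<close> and the factor p^2 cancel.
  What remains is \<theta> + K^2 * p \<le> (1 - p)^(n - 1), true for small \<open>\<rho>\<close>
  since p tends to 0 and \<open>\<theta> < 1\<close>. For empty \<open>C\<close> the factor n makes
  the remaining terms vanish.\<close>

lemma eventually_better_split_remainder:
  assumes Q: "Q > 0" and a: "\<And>i. i \<in> {1..K} \<Longrightarrow> a i \<ge> 0" and b: "\<And>i. i \<in> {1..K} \<Longrightarrow> b i \<ge> 0"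
    and C: "{i \<in> {1..K}. a i \<ge> 1} = C" "\<And>c. c \<in> C \<Longrightarrow> b c \<ge> 1"
    and j: "j \<in> {1..K}" "j \<notin> C" "b j = r" "0 < r" "r < 1"
    and I: "I = {i \<in> {1..K}. 0 < a i \<and> a i < 1}" "\<And>i. i \<in> I \<Longrightarrow> a i < r" "(\<Sum>i\<in>I. a i) \<le> r"
  shows "\<forall>\<^sub>F \<rho> in at_right 0. failure_prob M K Q hs hc b \<rho> \<le> failure_prob M K Q hs hc a \<rho>"
proof -
  let ?n = "card C" and ?p = "decode_prob Q"
  define A :: real where "A = 2 powr Q"
  have A: "A > 1" using Q by (simp add: A_def)
  have "\<exists>\<theta><1. \<forall>\<^sub>F \<rho> in at_right 0. (\<Sum>i\<in>I. pair_prob A (a i) \<rho>) \<le> \<theta> * pair_prob A r \<rho>"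
    by (rule pair_prob_sum_ratio[OF A j(5) _ _ I(2,3) j(4)]) (simp_all add: I(1))
  then obtain \<theta> where \<theta>: "\<theta> < 1"
    "\<forall>\<^sub>F \<rho> in at_right 0. (\<Sum>i\<in>I. pair_prob A (a i) \<rho>) \<le> \<theta> * pair_prob A r \<rho>" by blast
  have "((\<lambda>\<rho>. (1 - ?p \<rho>) ^ (?n - 1) - (real K)\<^sup>2 * ?p \<rho>) \<longlongrightarrow>
      (1 - 0) ^ (?n - 1) - (real K)\<^sup>2 * 0) (at_right 0)"
    by (intro tendsto_intros tendsto_decode_prob Q)
  hence "\<forall>\<^sub>F \<rho> in at_right 0. \<theta> < (1 - ?p \<rho>) ^ (?n - 1) - (real K)\<^sup>2 * ?p \<rho>"
    by (rule order_tendstoD) (use \<theta> in simp)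
  moreover have "\<forall>\<^sub>F \<rho> in at_right (0::real). \<rho> > 0"
    by (simp add: eventually_at_right_less)
  ultimately show ?thesis using \<theta>(2)
  proof eventually_elim
    case (elim \<rho>)
    let ?s = "\<lambda>a. prob {\<omega> \<in> space M. recovery_succeeds K Q hs hc a \<rho> \<omega>}"
    let ?H = "pair_prob A r \<rho>" and ?B = "prob (good_complete Q \<rho> C)"
    have H: "0 \<le> ?H" using pair_prob_nonneg elim A by simp
    have "?s a \<le> ?B + real ?n * ((?p \<rho>)\<^sup>2 * ((\<Sum>i\<in>I. pair_prob A (a i) \<rho>) + (real K)\<^sup>2 * ?p \<rho> * ?H))"
      unfolding A_def C(1)[symmetric] I(1)
      by (rule success_upper_fine[OF elim(2) Q a j(4,5)]) (use I in auto)
    also have "(\<Sum>i\<in>I. pair_prob A (a i) \<rho>) + (real K)\<^sup>2 * ?p \<rho> * ?H \<le>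
        \<theta> * ?H + (real K)\<^sup>2 * ?p \<rho> * ?H" using elim by simp
    also have "\<dots> = (\<theta> + (real K)\<^sup>2 * ?p \<rho>) * ?H" by (simp add: algebra_simps)
    also have "\<dots> \<le> (1 - ?p \<rho>) ^ (?n - 1) * ?H"
      using elim H by (intro mult_right_mono) auto
    finally have "?s a \<le> ?B + real ?n * ((?p \<rho>)\<^sup>2 * ((1 - ?p \<rho>) ^ (?n - 1) * ?H))"
      by (simp add: mult_left_mono)
    also have "\<dots> \<le> ?s b"
      unfolding A_def by (rule success_lower_fine[OF elim(2) Q]) (use b C j in auto)
    finally have "?s a \<le> ?s b" .
    moreover have "failure_prob M K Q hs hc a \<rho> = 1 - ?s a" "failure_prob M K Q hs hc b \<rho> = 1 - ?s b"
      by (rule failure_prob_eq[OF elim(2)]; fact a b)+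
    ultimately show ?case by linarith
  qed
qed

lemma failure_prob_mono:
  assumes \<rho>: "\<rho> > 0" and a: "\<And>i. i \<in> {1..K} \<Longrightarrow> a i \<ge> 0"
    and le: "\<And>i. i \<in> {1..K} \<Longrightarrow> min (a i) 1 \<le> b i"
  shows "failure_prob M K Q hs hc b \<rho> \<le> failure_prob M K Q hs hc a \<rho>"
proof -
  have b: "b i \<ge> 0" if "i \<in> {1..K}" for i using a[OF that] le[OF that] by linarith
  let ?s = "\<lambda>a. {\<omega> \<in> space M. recovery_succeeds K Q hs hc a \<rho> \<omega>}"
  have iff: "recovery_succeeds K Q hs hc c \<rho> \<omega> \<longleftrightarrow>
      recoverable (decoding_set K Q hs \<rho> \<omega>) c Q (\<lambda>i. link_rate \<rho> (hc i \<omega>))"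
    if "\<And>i. i \<in> {1..K} \<Longrightarrow> c i \<ge> 0" for c \<omega>
    by (rule recovery_succeeds_iff[OF \<rho>]) (rule that)
  have "prob (?s a) \<le> prob (?s b)"
  proof (rule finite_measure_mono)
    show "?s b \<in> events" by (rule recovery_succeeds_measurable[OF \<rho> b gain_measurable])
    show "?s a \<subseteq> ?s b"
    proof
      fix \<omega> assume \<omega>: "\<omega> \<in> ?s a"
      hence "recoverable (decoding_set K Q hs \<rho> \<omega>) a Q (\<lambda>i. link_rate \<rho> (hc i \<omega>))"
        using iff[of a, OF a] by blast
      hence "recoverable (decoding_set K Q hs \<rho> \<omega>) b Q (\<lambda>i. link_rate \<rho> (hc i \<omega>))"
        by (rule recoverable_mono) (use le decoding_set_subset[of K Q hs \<rho> \<omega>] in auto)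
      thus "\<omega> \<in> ?s b" using iff[of b, OF b] \<omega> by blast
    qed
  qed
  moreover have "failure_prob M K Q hs hc a \<rho> = 1 - prob (?s a)" "failure_prob M K Q hs hc b \<rho> = 1 - prob (?s b)"
    by (rule failure_prob_eq[OF \<rho>]; fact a b)+
  ultimately show ?thesis by linarith
qed

lemma min_allocation_eventually_optimal:
  assumes K: "K \<ge> 1" and Q: "Q > 0" and T: "T > 0"
    and min: "min_allocation K T b" and within: "allocation_within K T a"
  shows "\<forall>\<^sub>F \<rho> in at_right 0. failure_prob M K Q hs hc b \<rho> \<le> failure_prob M K Q hs hc a \<rho>"
proof -
  let ?N = "{1..K}"
  define r where "r = T - real_of_int \<lfloor>T\<rfloor>"
  have r: "0 \<le> r" "r < 1" by (auto simp: r_def) linarith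
  obtain C where C: "C \<subseteq> ?N" "int (card C) = \<lfloor>T\<rfloor>" "\<And>i. i \<in> C \<Longrightarrow> b i = 1"
    and rest: "if T \<in> \<int> then \<forall>i\<in>?N - C. b i = 0
         else \<exists>j\<in>?N - C. b j = r \<and> (\<forall>i\<in>?N - C - {j}. b i = 0)"
    using min unfolding min_allocation_def r_def by blast
  have cardT: "real (card C) + r = T" using C(2) unfolding r_def by linarith
  have T_int: "r = 0" if "T \<in> \<int>" using that by (auto simp: r_def elim: Ints_cases)
  have b: "b i \<ge> 0" if i: "i \<in> ?N" for i
  proof (cases "i \<in> C \<or> b i = 0")
    case False
    with rest i have "b i = r" by (auto split: if_splits)
    thus ?thesis using r by simp
  qed (use C in auto)
  have a: "a i \<ge> 0" if "i \<in> ?N" for i using within that by (simp add: allocation_within_def)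
  have sum_a: "(\<Sum>i\<in>?N. a i) \<le> T" using within by (simp add: allocation_within_def)
  define C' where "C' = {i \<in> ?N. a i \<ge> 1}"
  define I where "I = {i \<in> ?N. 0 < a i \<and> a i < 1}"
  have sum_split: "(\<Sum>i\<in>C'. a i) + (\<Sum>i\<in>I. a i) \<le> T"
  proof -
    have "(\<Sum>i\<in>C'. a i) + (\<Sum>i\<in>I. a i) = (\<Sum>i\<in>C' \<union> I. a i)"
      by (rule sum.union_disjoint[symmetric]) (auto simp: C'_def I_def)
    also have "\<dots> \<le> (\<Sum>i\<in>?N. a i)"
      by (rule sum_mono2) (use a in \<open>auto simp: C'_def I_def\<close>)
    finally show ?thesis using sum_a by simp
  qed
  have "real (card C') \<le> (\<Sum>i\<in>C'. a i)"
    using sum_mono[of C' "\<lambda>_. 1" a] by (simp add: C'_def)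
  with sum_split have card_split: "real (card C') + (\<Sum>i\<in>I. a i) \<le> T" by linarith
  have "0 \<le> (\<Sum>i\<in>I. a i)" by (rule sum_nonneg) (simp add: I_def)
  \<comment> \<open>Since \<open>r < 1\<close>, the real inequality forces
    \<open>card C' \<le> card C\<close> by integrality.\<close>
  with card_split have "real (card C') < real (card C) + 1" using cardT r by linarith
  hence "card C' \<le> card C" by linarith
  then consider "card C' < card C" | "card C' = card C" by linarith
  thus ?thesis
  proof cases
    case 1
    thus ?thesis
      by (intro eventually_better_fewer_complete[OF Q a b C(1)]) (use C in \<open>auto simp: C'_def\<close>)
  next
    case 2
    with card_split cardT have sum_I: "(\<Sum>i\<in>I. a i) \<le> r" by simp
    have fin: "finite C" "finite C'" "finite I" using C finite_subset by (auto simp: C'_def I_def)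
    obtain f where f: "bij_betw f C C'"
      using finite_same_card_bij[OF fin(1,2)] 2 by auto
    have CN: "C' \<subseteq> ?N" by (auto simp: C'_def)
    have aI: "a i \<le> r" if "i \<in> I" for i
    proof -
      have "a i \<le> (\<Sum>i\<in>I. a i)"
        by (rule member_le_sum) (use that fin in \<open>auto simp: I_def\<close>)
      thus ?thesis using sum_I by simp
    qed
    show ?thesis
    \<comment> \<open>At most one incomplete node allows pointwise domination after relabelling; two
      or more require the asymptotic comparison.\<close>
    proof (cases "\<exists>i. I \<subseteq> {i}")
      case True
      have "\<exists>\<pi>. bij_betw \<pi> ?N ?N \<and> (\<forall>i\<in>?N. min (a (\<pi> i)) 1 \<le> b i)"
      proof (cases "I = {}")
        case True
        obtain \<pi> where \<pi>: "bij_betw \<pi> ?N ?N" "\<And>x. x \<in> C \<Longrightarrow> \<pi> x = f x"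
          using bij_betw_extend[OF _ C(1) CN f] by auto
        have "min (a (\<pi> i)) 1 \<le> b i" if i: "i \<in> ?N" for i
        proof (cases "i \<in> C")
          case True
          thus ?thesis using C(3) by simp
        next
          case False
          have "\<pi> i \<in> ?N" using \<pi>(1) i bij_betwE by blast
          \<comment> \<open>\<open>\<pi>\<close> already maps \<open>C\<close> onto
            \<open>C'\<close>, so injectivity keeps every other node away from
            \<open>C'\<close>.\<close>
          moreover have "\<pi> i \<notin> C'"
          proof
            assume "\<pi> i \<in> C'"
            then obtain c where "c \<in> C" "\<pi> i = f c" using f by (auto simp: bij_betw_def)
            hence "\<pi> i = \<pi> c" "c \<in> ?N" using \<pi>(2) C(1) by auto
            hence "i = c" using \<pi>(1) i inj_onD[OF bij_betw_imp_inj_on] by metis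
            thus False using False \<open>c \<in> C\<close> by simp
          qed
          ultimately have "a (\<pi> i) = 0" using a[of "\<pi> i"] \<open>I = {}\<close> by (force simp: C'_def I_def)
          thus ?thesis using b[OF i] by simp
        qed
        with \<pi> show ?thesis by blast
      next
        case False
        with True obtain i0 where i0: "I = {i0}" by (meson subset_singletonD)
        have i0': "0 < a i0" "i0 \<in> ?N" "i0 \<notin> C'" using i0 by (auto simp: I_def C'_def)
        \<comment> \<open>A positive remainder rules out integer \<open>T\<close>, so the optimal
          allocation really has an incomplete node \<open>j\<close>; \<open>g\<close> then sends it
          to the single incomplete node \<open>i0\<close> of \<open>a\<close>.\<close>
        have "r \<noteq> 0" using aI[of i0] i0 i0' by auto
        with T_int rest obtain j where j: "j \<in> ?N - C" "b j = r" by (auto split: if_splits)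
        define g where "g x = (if x = j then i0 else f x)" for x
        have "bij_betw g C C'" using f j by (subst bij_betw_cong[of C g f]) (auto simp: g_def)
        hence "bij_betw g (C \<union> {j}) (C' \<union> {g j})"
          using j i0' by (intro notIn_Un_bij_betw) (auto simp: g_def)
        hence g: "bij_betw g (insert j C) (insert i0 C')" by (simp add: g_def)
        obtain \<pi> where \<pi>: "bij_betw \<pi> ?N ?N" "\<And>x. x \<in> insert j C \<Longrightarrow> \<pi> x = g x"
          using bij_betw_extend[OF _ _ _ g, of ?N] j C(1) CN i0' by auto
        have "min (a (\<pi> i)) 1 \<le> b i" if i: "i \<in> ?N" for i
        proof (cases "i \<in> insert j C")
          case True
          thus ?thesis using C(3) \<pi>(2)[of j] j aI i0 by (auto simp: g_def)
        next
          case False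
          have "\<pi> i \<in> ?N" using \<pi>(1) i bij_betwE by blast
          moreover have "\<pi> i \<notin> insert i0 C'"
          proof
            assume "\<pi> i \<in> insert i0 C'"
            then obtain c where c: "c \<in> insert j C" "\<pi> i = g c" using g by (metis bij_betw_imp_surj_on imageE)
            hence "\<pi> i = \<pi> c" "c \<in> ?N" using \<pi>(2) C(1) j by auto
            hence "i = c" using \<pi>(1) i inj_onD[OF bij_betw_imp_inj_on] by metis
            thus False using False c by simp
          qed
          ultimately have "a (\<pi> i) = 0" using a[of "\<pi> i"] i0 by (force simp: C'_def I_def)
          thus ?thesis using b[OF i] by simp
        qed
        with \<pi> show ?thesis by blast
      qed
      then obtain \<pi> where \<pi>: "bij_betw \<pi> ?N ?N" "\<And>i. i \<in> ?N \<Longrightarrow> min (a (\<pi> i)) 1 \<le> b i" by blast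
      have "failure_prob M K Q hs hc b \<rho> \<le> failure_prob M K Q hs hc a \<rho>" if \<rho>: "\<rho> > 0" for \<rho>
      proof -
        have "a (\<pi> i) \<ge> 0" if "i \<in> ?N" for i using a that \<pi>(1) bij_betwE by blast
        hence "failure_prob M K Q hs hc b \<rho> \<le> failure_prob M K Q hs hc (\<lambda>i. a (\<pi> i)) \<rho>"
          using \<pi>(2) by (rule failure_prob_mono[OF \<rho>])
        also have "\<dots> = failure_prob M K Q hs hc a \<rho>"
          by (rule failure_prob_permute[OF K \<rho> _ \<pi>(1)]) (rule a)
        finally show ?thesis .
      qed
      thus ?thesis by (intro eventually_mono[OF eventually_at_right_less]) auto
    next
      case False
      then obtain i1 where i1: "i1 \<in> I" by blast
      have "0 < a i1" using i1 by (simp add: I_def)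
      hence r0: "0 < r" using aI[OF i1] by simp
      with T_int rest obtain j where j: "j \<in> ?N - C" "b j = r" by (auto split: if_splits)
      \<comment> \<open>A second incomplete node takes a positive share of the budget
        \<open>r\<close>, which gives the strict inequality that the ratio bound needs.\<close>
      have aI': "a i < r" if i: "i \<in> I" for i
      proof -
        obtain i' where i': "i' \<in> I" "i' \<noteq> i" using False by blast
        have "a i + a i' = (\<Sum>k\<in>{i, i'}. a k)" using i' by simp
        also have "\<dots> \<le> (\<Sum>k\<in>I. a k)" by (rule sum_mono2) (use i i' fin in \<open>auto simp: I_def\<close>)
        finally show ?thesis using sum_I i' by (auto simp: I_def)
      qed
      obtain \<pi> where \<pi>: "bij_betw \<pi> ?N ?N" "\<And>x. x \<in> C \<Longrightarrow> \<pi> x = f x"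
        using bij_betw_extend[OF _ C(1) CN f] by auto
      have inN: "\<pi> i \<in> ?N" if "i \<in> ?N" for i using that \<pi>(1) bij_betwE by blast
      \<comment> \<open>Relabelling aligns the complete nodes of both allocations, so that the same
        \<open>good_complete\<close> event appears on either side.\<close>
      have C_eq: "{i \<in> ?N. a (\<pi> i) \<ge> 1} = C"
      proof (intro set_eqI iffI)
        fix i assume "i \<in> C"
        moreover from this have "\<pi> i \<in> C'" using \<pi>(2) f bij_betwE by metis
        ultimately show "i \<in> {i \<in> ?N. a (\<pi> i) \<ge> 1}" using C(1) by (auto simp: C'_def)
      next
        fix i assume i: "i \<in> {i \<in> ?N. a (\<pi> i) \<ge> 1}"
        hence "\<pi> i \<in> C'" using inN by (simp add: C'_def)
        then obtain c where "c \<in> C" "\<pi> i = f c" using f by (metis bij_betw_imp_surj_on imageE)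
        hence "\<pi> i = \<pi> c" "c \<in> ?N" using \<pi>(2) C(1) by auto
        hence "i = c" using \<pi>(1) i inj_onD[OF bij_betw_imp_inj_on] by (metis (no_types, lifting) mem_Collect_eq)
        thus "i \<in> C" using \<open>c \<in> C\<close> by simp
      qed
      define I' where "I' = {i \<in> ?N. 0 < a (\<pi> i) \<and> a (\<pi> i) < 1}"
      have "bij_betw \<pi> I' I"
        unfolding bij_betw_def
      proof
        show "inj_on \<pi> I'" using \<pi>(1) by (auto simp: bij_betw_def I'_def intro: inj_on_subset)
        show "\<pi> ` I' = I"
        proof
          show "\<pi> ` I' \<subseteq> I" using inN by (auto simp: I_def I'_def)
          show "I \<subseteq> \<pi> ` I'"
          proof
            fix x assume x: "x \<in> I"
            then obtain y where "y \<in> ?N" "x = \<pi> y"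
              using bij_betw_imp_surj_on[OF \<pi>(1)] unfolding I_def by (metis (no_types, lifting) imageE mem_Collect_eq)
            thus "x \<in> \<pi> ` I'" using x by (simp add: I_def I'_def)
          qed
        qed
      qed
      hence sum_I': "(\<Sum>i\<in>I'. a (\<pi> i)) \<le> r"
        using sum.reindex_bij_betw[of \<pi> I' I a] sum_I by simp
      have "\<forall>\<^sub>F \<rho> in at_right 0. failure_prob M K Q hs hc b \<rho> \<le> failure_prob M K Q hs hc (\<lambda>i. a (\<pi> i)) \<rho>"
      proof (rule eventually_better_split_remainder[where C = C and I = I' and j = j and r = r])
        show "0 \<le> a (\<pi> i)" if "i \<in> ?N" for i using a inN that by blast
        show "a (\<pi> i) < r" if "i \<in> I'" for i
        proof -
          have "\<pi> i \<in> I" using that inN by (simp add: I_def I'_def)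
          thus ?thesis by (rule aI')
        qed
        show "1 \<le> b c" if "c \<in> C" for c using C(3)[OF that] by simp
        show "0 \<le> b i" if "i \<in> ?N" for i using b that by blast
      qed (use Q C_eq j r0 r(2) I'_def sum_I' in simp_all)
      moreover have "\<forall>\<^sub>F \<rho> in at_right (0::real). \<rho> > 0"
        by (simp add: eventually_at_right_less)
      ultimately show ?thesis
      proof eventually_elim
        case (elim \<rho>)
        have "failure_prob M K Q hs hc (\<lambda>i. a (\<pi> i)) \<rho> = failure_prob M K Q hs hc a \<rho>"
          by (rule failure_prob_permute[OF K elim(2) _ \<pi>(1)]) (rule a)
        with elim(1) show ?case by simp
      qed
    qed
  qed
qed

end

theorem theorem3:
  fixes M :: "'w measure"
    and hs hc :: "nat \<Rightarrow> 'w \<Rightarrow> complex"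
    and K :: nat and Q T :: real
    and a_min :: "nat \<Rightarrow> real"
  assumes "K \<ge> 1" and "Q > 0" and "T > 0" and "int K \<ge> \<lceil>T\<rceil>"
    and "iid_gaussian_gains M K hs hc"
    and "min_allocation K T a_min"
  shows "\<forall>a. allocation_within K T a \<longrightarrow>
           (\<exists>\<rho>\<^sub>0>0. \<forall>\<rho>. 0 < \<rho> \<and> \<rho> < \<rho>\<^sub>0 \<longrightarrow>
              failure_prob M K Q hs hc a_min \<rho> \<le> failure_prob M K Q hs hc a \<rho>)"
proof (intro allI impI)
  fix a assume a: "allocation_within K T a"
  interpret iid_gains M K hs hc
    using assms(5) by (simp add: iid_gains_def iid_gains_axioms_def iid_gaussian_gains_def)
  from min_allocation_eventually_optimal[OF assms(1-3,6) a]
  show "\<exists>\<rho>\<^sub>0>0. \<forall>\<rho>. 0 < \<rho> \<and> \<rho> < \<rho>\<^sub>0 \<longrightarrow>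
      failure_prob M K Q hs hc a_min \<rho> \<le> failure_prob M K Q hs hc a \<rho>"
    unfolding eventually_at_right_field by blast
qed

end
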